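(* Let $\tau=\mathrm{Tr}/2$ on $M_2=M_2(\mathbb{C})$. Every undirected reflexive quantum graph $A$ on $(M_2,\tau)$ is classically isomorphic (and quantum isomorphic) to exactly one of the following $d$-regular quantum graphs $A_d$, $d\in\{1,2,3,4\}$, where matrices are with respect to the orthonormal basis $(\sqrt2 e_{11},\sqrt2 e_{12},\sqrt2 e_{21},\sqrt2 e_{22})$ of $L^2(M_2,\tau)$: $d=1$: the trivial graph $A_1=\mathrm{id}_{M_2}$, with $\mathrm{Spec}(A_1)=\{1,1,1,1\}$; $d=2$: $A_2=\begin{pmatrix}2&0&0&0\\0&0&0&0\\0&0&0&0\\0&0&0&2\end{pmatrix}$, with $\mathrm{Spec}(A_2)=\{2,2,0,0\}$; $d=3$: $A_3=\begin{pmatrix}1&0&0&2\\0&1&0&0\\0&0&1&0\\2&0&0&1\end{pmatrix}$, with $\mathrm{Spec}(A_3)=\{3,1,1,-1\}$; $d=4$: the complete graph $A_4=4\tau(\cdot)1=\begin{pmatrix}2&0&0&2\\0&0&0&0\\0&0&0&0\\2&0&0&2\end{pmatrix}$, with $\mathrm{Spec}(A_4)=\{4,0,0,0\}$. Here spectra are listed with multiplicity.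
   Context: Let $B$ be a finite-dimensional unital $C^*$-algebra with multiplication map $m:B\otimes B\to B$, unit $1$, and $\psi$ a faithful state on $B$; $L^2(B,\psi)$ is $B$ with inner product $\langle x|y\rangle_\psi=\psi(x^*y)$; $\dagger$ denotes Hilbert adjoints for these inner products (and $\psi\otimes\psi$ on $B\otimes B$). $(B,\psi)$ is a quantum set if $mm^\dagger=\delta^2\mathrm{id}_B$ for some $\delta>0$. A quantum graph on $(B,\psi)$ is a linear operator $A:B\to B$ with $m(A\otimes A)m^\dagger=\delta^2A$. It is real if $A(b^* )=A(b)^*$ for all $b$; undirected if it is real and $A^\dagger=A$; reflexive if $m(A\otimes\mathrm{id}_B)m^\dagger=\delta^2\mathrm{id}_B$; $d$-regular if $A1=d1$ and $\psi A=d\psi$. For $(M_2,\tau)$ one has $\delta=2$. $e_{ij}$ denote the matrix units of $M_2$. A quantum isomorphism $(H,P):(B',\psi',A')\to(B,\psi,A)$ is a pair of a finite-dimensional Hilbert space $H$ and a linear operator $P:B\otimes H\to H\otimes B'$ such that: writing $P(b\otimes h)=\sum_kP^k(b)h\otimes e'_k$ for a basis $\{e'_k\}$ of $B'$ and $\tilde P(b)=\sum_ke'_k\otimes P^k(b)$, the map $\tilde P:B\to B'\otimes B(H)$ is a unital $*$-homomorphism; $(\mathrm{id}_H\otimes\psi')P=\psi\otimes\mathrm{id}_H$; $(P\otimes\mathrm{id}_{B'})(\mathrm{id}_B\otimes P)(m^\dagger\otimes\mathrm{id}_H)=(\mathrm{id}_H\otimes m'^\dagger)P$; and $P(A\otimes\mathrm{id}_H)=(\mathrm{id}_H\otimes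 A')P$. It is classical if $\dim H=1$. Two quantum graphs are quantum (resp. classically) isomorphic if there is a nonzero quantum (resp. classical) isomorphism between them. *)

theory Defs
  imports
    "Jordan_Normal_Form.Char_Poly"
    "Jordan_Normal_Form.Schur_Decomposition"
    "HOL-Computational_Algebra.Polynomial"
begin

text \<open>
  The algebra \<open>B\<close> is the full matrix algebra \<open>M\<^sub>n\<close>, with elements the matrices in
  \<open>carrier_mat n n\<close>. Its matrix units are enumerated row by row: the number \<open>p < n * n\<close> stands for
  \<open>e\<^sub>i\<^sub>j\<close> with \<open>i = p div n\<close> and \<open>j = p mod n\<close>. Linear maps between tensor products of copies of
  \<open>M\<^sub>n\<close> and of a Hilbert space \<open>H = \<complex>\<^sup>K\<close> are given by their matrices with respect to the
  lexicographically ordered tensor bases, so that composition is matrix multiplication, the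
  identity is \<open>1\<^sub>m\<close> and the tensor product of maps is the Kronecker product. The latter is strictly
  associative, and \<open>\<complex>\<close> with basis \<open>1\<close> is a strict unit for it.
\<close>

definition kron :: "complex mat \<Rightarrow> complex mat \<Rightarrow> complex mat" where
  "kron X Y = mat (dim_row X * dim_row Y) (dim_col X * dim_col Y)
     (\<lambda>(i, j). X $$ (i div dim_row Y, j div dim_col Y) * Y $$ (i mod dim_row Y, j mod dim_col Y))"

definition munit :: "nat \<Rightarrow> nat \<Rightarrow> complex mat" where
  "munit n p = mat n n (\<lambda>(i, j). if p = i * n + j then 1 else 0)"

definition coords :: "nat \<Rightarrow> complex mat \<Rightarrow> complex vec" where
  "coords n b = vec (n * n) (\<lambda>p. b $$ (p div n, p mod n))"

definition of_coords :: "nat \<Rightarrow> complex vec \<Rightarrow> complex mat" where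
  "of_coords n v = mat n n (\<lambda>(i, j). v $ (i * n + j))"

definition apply_op :: "nat \<Rightarrow> complex mat \<Rightarrow> complex mat \<Rightarrow> complex mat" where
  "apply_op n A b = of_coords n (A *\<^sub>v coords n b)"

definition mult_map :: "nat \<Rightarrow> complex mat" where
  "mult_map n = mat (n * n) ((n * n) * (n * n))
     (\<lambda>(r, c). coords n (munit n (c div (n * n)) * munit n (c mod (n * n))) $ r)"


definition faithful_state :: "nat \<Rightarrow> (complex mat \<Rightarrow> complex) \<Rightarrow> bool" where
  "faithful_state n \<psi> \<longleftrightarrow>
     (\<forall>x \<in> carrier_mat n n. \<forall>y \<in> carrier_mat n n. \<psi> (x + y) = \<psi> x + \<psi> y) \<and>
     (\<forall>c. \<forall>x \<in> carrier_mat n n. \<psi> (c \<cdot>\<^sub>m x) = c * \<psi> x) \<and>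
     (\<forall>x \<in> carrier_mat n n. Im (\<psi> (mat_adjoint x * x)) = 0 \<and> Re (\<psi> (mat_adjoint x * x)) \<ge> 0) \<and>
     \<psi> (1\<^sub>m n) = 1 \<and>
     (\<forall>x \<in> carrier_mat n n. \<psi> (mat_adjoint x * x) = 0 \<longrightarrow> x = 0\<^sub>m n n)"

definition functional_mat :: "nat \<Rightarrow> (complex mat \<Rightarrow> complex) \<Rightarrow> complex mat" where
  "functional_mat n \<psi> = mat 1 (n * n) (\<lambda>(_, p). \<psi> (munit n p))"

text \<open>Inner products, conjugate linear in the first argument, are given by their Gram matrices;
  the Gram matrix of a tensor product of Hilbert spaces is the Kronecker product. The adjoint
  \<open>hadjoint G G' T\<close> is taken for \<open>T\<close> from the space with Gram matrix \<open>G\<close> to the one with Gram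
  matrix \<open>G'\<close>; it exists and is unique as soon as \<open>G\<close> is positive definite.\<close>

definition gram :: "nat \<Rightarrow> (complex mat \<Rightarrow> complex) \<Rightarrow> complex mat" where
  "gram n \<psi> = mat (n * n) (n * n) (\<lambda>(p, q). \<psi> (mat_adjoint (munit n p) * munit n q))"

definition ip :: "complex mat \<Rightarrow> complex vec \<Rightarrow> complex vec \<Rightarrow> complex" where
  "ip G v w = conjugate v \<bullet> (G *\<^sub>v w)"

definition hadjoint :: "complex mat \<Rightarrow> complex mat \<Rightarrow> complex mat \<Rightarrow> complex mat" where
  "hadjoint G G' T = (THE S. S \<in> carrier_mat (dim_col T) (dim_row T) \<and>
     (\<forall>v \<in> carrier_vec (dim_col T). \<forall>w \<in> carrier_vec (dim_row T).
        ip G' (T *\<^sub>v v) w = ip G v (S *\<^sub>v w)))"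

definition comult_map :: "nat \<Rightarrow> (complex mat \<Rightarrow> complex) \<Rightarrow> complex mat" where
  "comult_map n \<psi> = hadjoint (kron (gram n \<psi>) (gram n \<psi>)) (gram n \<psi>) (mult_map n)"

definition quantum_set :: "nat \<Rightarrow> (complex mat \<Rightarrow> complex) \<Rightarrow> real \<Rightarrow> bool" where
  "quantum_set n \<psi> \<delta> \<longleftrightarrow> n > 0 \<and> faithful_state n \<psi> \<and> \<delta> > 0 \<and>
     mult_map n * comult_map n \<psi> = (complex_of_real \<delta>)\<^sup>2 \<cdot>\<^sub>m 1\<^sub>m (n * n)"

definition quantum_graph :: "nat \<Rightarrow> (complex mat \<Rightarrow> complex) \<Rightarrow> real \<Rightarrow> complex mat \<Rightarrow> bool" where
  "quantum_graph n \<psi> \<delta> A \<longleftrightarrow> quantum_set n \<psi> \<delta> \<and> A \<in> carrier_mat (n * n) (n * n) \<and>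
     mult_map n * kron A A * comult_map n \<psi> = (complex_of_real \<delta>)\<^sup>2 \<cdot>\<^sub>m A"

definition real_graph :: "nat \<Rightarrow> complex mat \<Rightarrow> bool" where
  "real_graph n A \<longleftrightarrow>
     (\<forall>b \<in> carrier_mat n n. apply_op n A (mat_adjoint b) = mat_adjoint (apply_op n A b))"

definition undirected_graph :: "nat \<Rightarrow> (complex mat \<Rightarrow> complex) \<Rightarrow> complex mat \<Rightarrow> bool" where
  "undirected_graph n \<psi> A \<longleftrightarrow> real_graph n A \<and> hadjoint (gram n \<psi>) (gram n \<psi>) A = A"

definition reflexive_graph :: "nat \<Rightarrow> (complex mat \<Rightarrow> complex) \<Rightarrow> real \<Rightarrow> complex mat \<Rightarrow> bool" where
  "reflexive_graph n \<psi> \<delta> A \<longleftrightarrow>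
     mult_map n * kron A (1\<^sub>m (n * n)) * comult_map n \<psi> = (complex_of_real \<delta>)\<^sup>2 \<cdot>\<^sub>m 1\<^sub>m (n * n)"

definition regular_graph :: "nat \<Rightarrow> (complex mat \<Rightarrow> complex) \<Rightarrow> complex \<Rightarrow> complex mat \<Rightarrow> bool" where
  "regular_graph n \<psi> d A \<longleftrightarrow> apply_op n A (1\<^sub>m n) = d \<cdot>\<^sub>m 1\<^sub>m n \<and>
     (\<forall>b \<in> carrier_mat n n. \<psi> (apply_op n A b) = d * \<psi> b)"


text \<open>For \<open>P : M\<^sub>n \<otimes> \<complex>\<^sup>K \<rightarrow> \<complex>\<^sup>K \<otimes> M\<^sub>m\<close>, the operator \<open>iso_component n m K P q b\<close> on \<open>\<complex>\<^sup>K\<close> is the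
  \<open>P\<^sup>q(b)\<close> in \<open>P(b \<otimes> h) = (\<Sum>q. P\<^sup>q(b) h \<otimes> e'\<^sub>q)\<close>, where the \<open>e'\<^sub>q\<close> are the matrix units of \<open>M\<^sub>m\<close>.
  Then \<open>iso_hom n m K P b\<close> is \<open>\<Sum>q. e'\<^sub>q \<otimes> P\<^sup>q(b)\<close> (which does not depend on the choice of basis), with
  the algebra \<open>M\<^sub>m \<otimes> B(\<complex>\<^sup>K)\<close> identified with the matrices of size \<open>m * K\<close> by the Kronecker product.\<close>

definition iso_component ::
  "nat \<Rightarrow> nat \<Rightarrow> nat \<Rightarrow> complex mat \<Rightarrow> nat \<Rightarrow> complex mat \<Rightarrow> complex mat" where
  "iso_component n m K P q b = mat K K
     (\<lambda>(s, t). \<Sum>p < n * n. P $$ (s * (m * m) + q, p * K + t) * coords n b $ p)"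

definition iso_hom ::
  "nat \<Rightarrow> nat \<Rightarrow> nat \<Rightarrow> complex mat \<Rightarrow> complex mat \<Rightarrow> complex mat" where
  "iso_hom n m K P b = mat (m * K) (m * K)
     (\<lambda>ij. \<Sum>q < m * m. kron (munit m q) (iso_component n m K P q b) $$ ij)"

definition unital_star_hom :: "nat \<Rightarrow> nat \<Rightarrow> (complex mat \<Rightarrow> complex mat) \<Rightarrow> bool" where
  "unital_star_hom n N f \<longleftrightarrow>
     (\<forall>x \<in> carrier_mat n n. f x \<in> carrier_mat N N) \<and>
     (\<forall>x \<in> carrier_mat n n. \<forall>y \<in> carrier_mat n n. f (x + y) = f x + f y) \<and>
     (\<forall>c. \<forall>x \<in> carrier_mat n n. f (c \<cdot>\<^sub>m x) = c \<cdot>\<^sub>m f x) \<and>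
     (\<forall>x \<in> carrier_mat n n. \<forall>y \<in> carrier_mat n n. f (x * y) = f x * f y) \<and>
     (\<forall>x \<in> carrier_mat n n. f (mat_adjoint x) = mat_adjoint (f x)) \<and>
     f (1\<^sub>m n) = 1\<^sub>m N"

text \<open>A triple \<open>(n, \<psi>, A)\<close> stands for the quantum graph \<open>A\<close> on \<open>(M\<^sub>n, \<psi>)\<close>. In
  \<open>quantum_isomorphism K P X Y\<close> the pair \<open>(\<complex>\<^sup>K, P)\<close> is a morphism from \<open>X\<close> to \<open>Y\<close>, while the linear
  map \<open>P\<close> goes from (algebra of \<open>Y\<close>) \<open>\<otimes> \<complex>\<^sup>K\<close> to \<open>\<complex>\<^sup>K \<otimes>\<close> (algebra of \<open>X\<close>).\<close>

type_synonym qgraph = "nat \<times> (complex mat \<Rightarrow> complex) \<times> complex mat"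

fun quantum_isomorphism :: "nat \<Rightarrow> complex mat \<Rightarrow> qgraph \<Rightarrow> qgraph \<Rightarrow> bool" where
  "quantum_isomorphism K P (m, \<psi>', A') (n, \<psi>, A) \<longleftrightarrow>
     P \<in> carrier_mat (K * (m * m)) ((n * n) * K) \<and>
     unital_star_hom n (m * K) (iso_hom n m K P) \<and>
     kron (1\<^sub>m K) (functional_mat m \<psi>') * P = kron (functional_mat n \<psi>) (1\<^sub>m K) \<and>
     kron P (1\<^sub>m (m * m)) * kron (1\<^sub>m (n * n)) P * kron (comult_map n \<psi>) (1\<^sub>m K)
       = kron (1\<^sub>m K) (comult_map m \<psi>') * P \<and>
     P * kron A (1\<^sub>m K) = kron (1\<^sub>m K) A' * P"

definition quantum_isomorphic :: "qgraph \<Rightarrow> qgraph \<Rightarrow> bool" where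
  "quantum_isomorphic X Y \<longleftrightarrow>
     (\<exists>K P. quantum_isomorphism K P X Y \<and> P \<noteq> 0\<^sub>m (dim_row P) (dim_col P))"

definition classically_isomorphic :: "qgraph \<Rightarrow> qgraph \<Rightarrow> bool" where
  "classically_isomorphic X Y \<longleftrightarrow>
     (\<exists>P. quantum_isomorphism 1 P X Y \<and> P \<noteq> 0\<^sub>m (dim_row P) (dim_col P))"


definition tau :: "complex mat \<Rightarrow> complex" where
  "tau x = (x $$ (0, 0) + x $$ (1, 1)) / 2"

definition onb :: "nat \<Rightarrow> complex mat" where
  "onb p = complex_of_real (sqrt 2) \<cdot>\<^sub>m munit 2 p"

definition qgraph_mat :: "nat \<Rightarrow> complex mat" where
  "qgraph_mat d = mat_of_rows_list 4
     (if d = 1 then [[1, 0, 0, 0], [0, 1, 0, 0], [0, 0, 1, 0], [0, 0, 0, 1]]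
      else if d = 2 then [[2, 0, 0, 0], [0, 0, 0, 0], [0, 0, 0, 0], [0, 0, 0, 2]]
      else if d = 3 then [[1, 0, 0, 2], [0, 1, 0, 0], [0, 0, 1, 0], [2, 0, 0, 1]]
      else [[2, 0, 0, 2], [0, 0, 0, 0], [0, 0, 0, 0], [2, 0, 0, 2]])"

text \<open>For an operator on \<open>M\<^sub>2\<close>, the matrix with respect to the orthonormal basis \<open>onb\<close> is the same as
  the one with respect to the matrix units, since \<open>onb\<close> differs from them by a common factor.\<close>

lemma apply_op_onb:
  assumes "A \<in> carrier_mat 4 4" and "q < 4"
  shows "apply_op 2 A (onb q) = mat 2 2 (\<lambda>ij. \<Sum>p < 4. A $$ (p, q) * onb p $$ ij)"
proof (rule eq_matI)
  fix i j assume "i < dim_row (mat 2 2 (\<lambda>ij. \<Sum>p < 4. A $$ (p, q) * onb p $$ ij))"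
    and "j < dim_col (mat 2 2 (\<lambda>ij. \<Sum>p < 4. A $$ (p, q) * onb p $$ ij))"
  then have ij: "i < 2" "j < 2" by auto
  then have r: "i * 2 + j < 4" by linarith
  have onb: "onb p $$ (i, j) = (if p = i * 2 + j then complex_of_real (sqrt 2) else 0)" for p
    using ij by (simp add: onb_def munit_def)
  have c: "coords 2 (onb q) $ p = (if p = q then complex_of_real (sqrt 2) else 0)" if "p < 4" for p
  proof -
    have "p div 2 < 2" using that by linarith
    then show ?thesis using that by (simp add: coords_def onb_def munit_def)
  qed
  have "apply_op 2 A (onb q) $$ (i, j) = (\<Sum>p \<in> {0..<4}. A $$ (i * 2 + j, p) * coords 2 (onb q) $ p)"
    using ij r assms(1) by (simp add: apply_op_def of_coords_def scalar_prod_def coords_def)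
  also have "\<dots> = (\<Sum>p \<in> {0..<4}. if p = q then A $$ (i * 2 + j, p) * complex_of_real (sqrt 2) else 0)"
    by (rule sum.cong) (simp_all add: c)
  also have "\<dots> = A $$ (i * 2 + j, q) * complex_of_real (sqrt 2)"
    using assms(2) by (subst sum.delta) auto
  finally have 1: "apply_op 2 A (onb q) $$ (i, j) = A $$ (i * 2 + j, q) * complex_of_real (sqrt 2)" .
  have "(\<Sum>p < 4. A $$ (p, q) * onb p $$ (i, j))
      = (\<Sum>p < 4. if p = i * 2 + j then A $$ (p, q) * complex_of_real (sqrt 2) else 0)"
    by (rule sum.cong) (simp_all add: onb)
  also have "\<dots> = A $$ (i * 2 + j, q) * complex_of_real (sqrt 2)"
    using r by (subst sum.delta) auto
  finally show "apply_op 2 A (onb q) $$ (i, j)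
      = mat 2 2 (\<lambda>ij. \<Sum>p < 4. A $$ (p, q) * onb p $$ ij) $$ (i, j)"
    using 1 ij by simp
qed (simp_all add: apply_op_def of_coords_def)

definition spectrum_mset :: "complex mat \<Rightarrow> complex multiset" where
  "spectrum_mset A = proots (char_poly A)"

end

theory Submission
  imports Defs
begin

text \<open>Write an operator on \<open>M\<^sub>2\<close> as \<open>b \<mapsto> (\<Sum>k l. c\<^sub>k\<^sub>l \<cdot> (\<sigma>\<^sub>k * b * \<sigma>\<^sub>l))\<close> with \<open>\<sigma>\<^sub>0 = 1\<close> and the Pauli
  matrices \<open>\<sigma>\<^sub>1, \<sigma>\<^sub>2, \<sigma>\<^sub>3\<close>. Reality says that \<open>c\<close> is Hermitian, and self-adjointness then makes \<open>c\<close>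
  real and symmetric. Reflexivity says that the first column of \<open>c\<close> is \<open>(1, 0, 0, 0)\<close>. Since
  convolution of operators is multiplication of Choi matrices (\<open>convolution_index\<close>), the quantum
  graph equation says \<open>c\<^sup>2 = c\<close>. So an undirected reflexive quantum graph is a real symmetric
  projection \<open>Q\<close> of size three (\<open>pauli_op_exists\<close>, \<open>pauli_op_projection\<close>).

  Such a \<open>Q\<close> is \<open>0\<close>, the projection \<open>n n\<^sup>T\<close> onto the line of
  a unit vector \<open>n\<close>, its complement \<open>1 - n n\<^sup>T\<close>, or \<open>1\<close>
  (\<open>projection_3_trace\<close>, \<open>projection_3_rank_one\<close>), and \<open>d\<close> is one more than its rank. With
  \<open>S = n\<^sub>1 \<sigma>\<^sub>1 + n\<^sub>2 \<sigma>\<^sub>2 + n\<^sub>3 \<sigma>\<^sub>3\<close> the graph is correspondingly the identity, \<open>b \<mapsto> b + S * b * S\<close>,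
  \<open>b \<mapsto> 4 \<tau>(b) - S * b * S\<close>, or \<open>b \<mapsto> 4 \<tau>(b)\<close>. The model graphs are the cases \<open>S = \<sigma>\<^sub>3\<close>. A unitary
  that conjugates \<open>\<sigma>\<^sub>3\<close> to \<open>S\<close> exists (\<open>spin_diagonalised\<close>), and conjugation by it is a classical
  isomorphism onto the model (\<open>conj_quantum_isomorphism\<close>).

  No two models are even quantum isomorphic: a quantum isomorphism \<open>P\<close> maps \<open>1 \<otimes> h\<close> to
  \<open>h \<otimes> 1\<close> and intertwines the graphs, so it preserves the eigenvalue \<open>d\<close> of the unit
  (\<open>quantum_isomorphism_degree\<close>).\<close>

section \<open>Tensor products of matrices\<close>

lemma sum_product_index:
  fixes f :: "nat \<Rightarrow> 'a :: comm_monoid_add"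
  shows "(\<Sum>x<a * b. f x) = (\<Sum>p<a. \<Sum>q<b. f (p * b + q))"
proof -
  have "(\<Sum>p<a. \<Sum>q<b. f (p * b + q)) = (\<Sum>p<a. sum f {p * b..<p * b + b})"
  proof (rule sum.cong[OF refl])
    fix p
    show "(\<Sum>q<b. f (p * b + q)) = sum f {p * b..<p * b + b}"
      using sum.shift_bounds_nat_ivl[of f 0 "p * b" b] by (simp add: lessThan_atLeast0 add.commute)
  qed
  then show ?thesis
    using sum.nat_group[of f b a] by simp
qed

lemma product_index_less:
  "i < a \<Longrightarrow> k < b \<Longrightarrow> i * b + k < a * (b :: nat)"
proof -
  assume "i < a" "k < b"
  then have "Suc i * b \<le> a * b" by (intro mult_right_mono) auto
  with \<open>k < b\<close> show ?thesis by simp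
qed

lemma index_product_split:
  assumes "x < a * (b :: nat)"
  obtains i k where "i < a" "k < b" "x = i * b + k"
  by (metis assms bot_nat_0.not_eq_extremum div_mult_mod_eq less_mult_imp_div_less
      mod_less_divisor mult_0_right not_less0)

lemma product_index_inj:
  assumes "k < b" "l < (b :: nat)"
  shows "i * b + k = j * b + l \<longleftrightarrow> i = j \<and> k = l"
proof
  assume eq: "i * b + k = j * b + l"
  have "i = (i * b + k) div b" "j = (j * b + l) div b" "k = (i * b + k) mod b" "l = (j * b + l) mod b"
    using assms by auto
  with eq show "i = j \<and> k = l" by metis
qed simp

lemma kron_dim [simp]:
  "dim_row (kron X Y) = dim_row X * dim_row Y" "dim_col (kron X Y) = dim_col X * dim_col Y"
  by (simp_all add: kron_def)

lemma kron_carrier [intro, simp]: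
  "X \<in> carrier_mat a b \<Longrightarrow> Y \<in> carrier_mat c d \<Longrightarrow> kron X Y \<in> carrier_mat (a * c) (b * d)"
  by auto

lemma kron_index:
  assumes "X \<in> carrier_mat a b" "Y \<in> carrier_mat c d" "i < a" "k < c" "j < b" "l < d"
  shows "kron X Y $$ (i * c + k, j * d + l) = X $$ (i, j) * Y $$ (k, l)"
proof -
  have "i * c + k < a * c" "j * d + l < b * d"
    using assms product_index_less by auto
  then show ?thesis
    using assms by (auto simp: kron_def)
qed

lemma mat_mult_index:
  assumes "X \<in> carrier_mat a n" "Y \<in> carrier_mat n b" "i < a" "j < b"
  shows "(X * Y) $$ (i, j) = (\<Sum>k<n. X $$ (i, k) * Y $$ (k, j))"
  using assms by (auto simp: scalar_prod_def lessThan_atLeast0)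

lemma mult_mat_vec_index:
  assumes "X \<in> carrier_mat a n" "v \<in> carrier_vec n" "i < a"
  shows "(X *\<^sub>v v) $ i = (\<Sum>k<n. X $$ (i, k) * v $ k)"
  using assms by (auto simp: scalar_prod_def lessThan_atLeast0)

lemma kron_mult:
  assumes "X \<in> carrier_mat a b" "X' \<in> carrier_mat b c" "Y \<in> carrier_mat p q" "Y' \<in> carrier_mat q r"
  shows "kron X Y * kron X' Y' = kron (X * X') (Y * Y')"
proof (rule eq_matI)
  fix x y assume "x < dim_row (kron (X * X') (Y * Y'))" "y < dim_col (kron (X * X') (Y * Y'))"
  with assms have "x < a * p" "y < c * r" by auto
  then obtain i k j l where ik: "i < a" "k < p" "x = i * p + k" and jl: "j < c" "l < r" "y = j * r + l"
    by (meson index_product_split)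
  have carr: "kron X Y \<in> carrier_mat (a * p) (b * q)" "kron X' Y' \<in> carrier_mat (b * q) (c * r)"
    using assms by auto
  have "(kron X Y * kron X' Y') $$ (x, y)
      = (\<Sum>s<b. \<Sum>t<q. kron X Y $$ (x, s * q + t) * kron X' Y' $$ (s * q + t, y))"
    using mat_mult_index[OF carr \<open>x < a * p\<close> \<open>y < c * r\<close>] by (simp add: sum_product_index)
  also have "\<dots> = (\<Sum>s<b. \<Sum>t<q. (X $$ (i, s) * X' $$ (s, j)) * (Y $$ (k, t) * Y' $$ (t, l)))"
    unfolding ik jl
    by (intro sum.cong refl)
       (simp add: kron_index[OF assms(1,3)] kron_index[OF assms(2,4)] ik jl)
  also have "\<dots> = (X * X') $$ (i, j) * (Y * Y') $$ (k, l)"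
    using mat_mult_index[OF assms(1,2) ik(1) jl(1)] mat_mult_index[OF assms(3,4) ik(2) jl(2)]
    by (simp only: sum_product)
  also have "\<dots> = kron (X * X') (Y * Y') $$ (x, y)"
    unfolding ik jl using assms ik jl by (intro kron_index[symmetric]) auto
  finally show "(kron X Y * kron X' Y') $$ (x, y) = kron (X * X') (Y * Y') $$ (x, y)" .
qed (use assms in auto)

lemma kron_one_left [simp]: "kron (1\<^sub>m 1) X = X"
  by (rule eq_matI) (auto simp: kron_def)

lemma kron_one_right [simp]: "kron X (1\<^sub>m 1) = X"
  by (rule eq_matI) (auto simp: kron_def)

lemma kron_one_one: "kron (1\<^sub>m a) (1\<^sub>m b) = 1\<^sub>m (a * b)"
proof (rule eq_matI)
  fix x y assume "x < dim_row (1\<^sub>m (a * b) :: complex mat)" "y < dim_col (1\<^sub>m (a * b) :: complex mat)"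
  then have "x < a * b" "y < a * b" by auto
  moreover have "x div b = y div b \<and> x mod b = y mod b \<longleftrightarrow> x = y"
    by (metis div_mult_mod_eq)
  ultimately show "kron (1\<^sub>m a) (1\<^sub>m b) $$ (x, y) = 1\<^sub>m (a * b) $$ (x, y)"
    by (auto simp: kron_def less_mult_imp_div_less elim: index_product_split)
qed auto

lemma kron_scaled: "kron (a \<cdot>\<^sub>m X) (b \<cdot>\<^sub>m Y) = (a * b) \<cdot>\<^sub>m kron X Y"
proof (rule eq_matI)
  fix x y assume "x < dim_row ((a * b) \<cdot>\<^sub>m kron X Y)" "y < dim_col ((a * b) \<cdot>\<^sub>m kron X Y)"
  then have "x < dim_row X * dim_row Y" "y < dim_col X * dim_col Y" by auto
  moreover from this have "0 < dim_row Y" "0 < dim_col Y" using gr0I by fastforce+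
  ultimately show "kron (a \<cdot>\<^sub>m X) (b \<cdot>\<^sub>m Y) $$ (x, y) = ((a * b) \<cdot>\<^sub>m kron X Y) $$ (x, y)"
    by (simp add: kron_def less_mult_imp_div_less)
qed auto

section \<open>Conjugate transposes\<close>

lemma mat_adjoint_dim [simp]:
  "dim_row (mat_adjoint X) = dim_col X" "dim_col (mat_adjoint X) = dim_row X"
  by (simp_all add: mat_adjoint_def)

lemma mat_adjoint_carrier [intro, simp]:
  "X \<in> carrier_mat a b \<Longrightarrow> mat_adjoint X \<in> carrier_mat b a"
  by auto

lemma mat_adjoint_index [simp]:
  fixes X :: "complex mat"
  shows "i < dim_col X \<Longrightarrow> j < dim_row X \<Longrightarrow> mat_adjoint X $$ (i, j) = cnj (X $$ (j, i))"
  by (simp add: mat_adjoint_def mat_of_rows_index)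

lemma mat_adjoint_mult:
  fixes X Y :: "complex mat"
  assumes "X \<in> carrier_mat a b" "Y \<in> carrier_mat b c"
  shows "mat_adjoint (X * Y) = mat_adjoint Y * mat_adjoint X"
proof (rule eq_matI)
  fix i j assume "i < dim_row (mat_adjoint Y * mat_adjoint X)" "j < dim_col (mat_adjoint Y * mat_adjoint X)"
  then have ij: "i < c" "j < a" using assms by auto
  have "mat_adjoint (X * Y) $$ (i, j) = cnj ((X * Y) $$ (j, i))"
    using assms ij by (intro mat_adjoint_index) auto
  also have "\<dots> = (\<Sum>k<b. cnj (X $$ (j, k)) * cnj (Y $$ (k, i)))"
    unfolding mat_mult_index[OF assms ij(2,1)] by simp
  also have "\<dots> = (\<Sum>k<b. mat_adjoint Y $$ (i, k) * mat_adjoint X $$ (k, j))"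
    using assms ij by (intro sum.cong refl) (simp add: mult.commute)
  also have "\<dots> = (mat_adjoint Y * mat_adjoint X) $$ (i, j)"
    using assms ij by (intro mat_mult_index[symmetric]) auto
  finally show "mat_adjoint (X * Y) $$ (i, j) = (mat_adjoint Y * mat_adjoint X) $$ (i, j)" .
qed (use assms in auto)

lemma mat_adjoint_adjoint [simp]: "mat_adjoint (mat_adjoint X) = (X :: complex mat)"
  by (rule eq_matI) auto

lemma unitary_orthonormal:
  fixes U :: "complex mat"
  assumes U: "U \<in> carrier_mat n n" "mat_adjoint U * U = 1\<^sub>m n" "i < n" "j < n"
  shows "(\<Sum>k<n. U $$ (k, i) * cnj (U $$ (k, j))) = (if i = j then 1 else 0)"
proof -
  have "(mat_adjoint U * U) $$ (j, i) = (\<Sum>k<n. mat_adjoint U $$ (j, k) * U $$ (k, i))"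
    using U by (intro mat_mult_index) auto
  also have "\<dots> = (\<Sum>k<n. U $$ (k, i) * cnj (U $$ (k, j)))"
    using U by (intro sum.cong refl) (simp add: mult.commute)
  finally show ?thesis using U by auto
qed

lemma unitary_orthonormal_rows:
  fixes U :: "complex mat"
  assumes U: "U \<in> carrier_mat n n" "U * mat_adjoint U = 1\<^sub>m n" "i < n" "j < n"
  shows "(\<Sum>k<n. U $$ (i, k) * cnj (U $$ (j, k))) = (if i = j then 1 else 0)"
proof -
  have "(U * mat_adjoint U) $$ (i, j) = (\<Sum>k<n. U $$ (i, k) * mat_adjoint U $$ (k, j))"
    using U by (intro mat_mult_index) auto
  also have "\<dots> = (\<Sum>k<n. U $$ (i, k) * cnj (U $$ (j, k)))"
    using U by (intro sum.cong refl) simp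
  finally show ?thesis using U by auto
qed

lemma smult_mat_mult_vec:
  fixes c :: complex
  assumes "X \<in> carrier_mat a b" "v \<in> carrier_vec b"
  shows "(c \<cdot>\<^sub>m X) *\<^sub>v v = c \<cdot>\<^sub>v (X *\<^sub>v v)"
  using assms by (intro eq_vecI) (auto simp: scalar_prod_def sum_distrib_left mult.assoc)

lemma ip_scaled:
  assumes "v \<in> carrier_vec n" "w \<in> carrier_vec n"
  shows "ip (c \<cdot>\<^sub>m 1\<^sub>m n) v w = c * (conjugate v \<bullet> w)"
  using assms by (simp add: ip_def smult_mat_mult_vec[where a = n and b = n])

text \<open>The Gram matrices that occur are multiples of the identity, since the matrix units are
  orthogonal and of equal length for the trace. The adjoint is then the conjugate transpose up to
  a factor.\<close>
lemma hadjoint_scaled: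
  fixes T :: "complex mat"
  assumes T: "T \<in> carrier_mat m n" and c: "c \<noteq> 0"
  shows "hadjoint (c \<cdot>\<^sub>m 1\<^sub>m n) (c' \<cdot>\<^sub>m 1\<^sub>m m) T = (c' / c) \<cdot>\<^sub>m mat_adjoint T"
    (is "_ = ?S")
  unfolding hadjoint_def
proof (rule the_equality, intro conjI ballI)
  have adj: "conjugate (T *\<^sub>v v) \<bullet> w = conjugate v \<bullet> (mat_adjoint T *\<^sub>v w)"
    if vw: "v \<in> carrier_vec n" "w \<in> carrier_vec m" for v w
  proof -
    have "conjugate (T *\<^sub>v v) \<bullet> w = (\<Sum>i<m. \<Sum>j<n. cnj (T $$ (i, j)) * cnj (v $ j) * w $ i)"
      using vw T by (simp add: scalar_prod_def lessThan_atLeast0 sum_distrib_right)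
    also have "\<dots> = (\<Sum>j<n. \<Sum>i<m. cnj (T $$ (i, j)) * cnj (v $ j) * w $ i)"
      by (rule sum.swap)
    also have "\<dots> = conjugate v \<bullet> (mat_adjoint T *\<^sub>v w)"
      using vw T by (simp add: scalar_prod_def lessThan_atLeast0 sum_distrib_left mult_ac)
    finally show ?thesis .
  qed
  show "?S \<in> carrier_mat (dim_col T) (dim_row T)"
    using T by auto
  show "ip (c' \<cdot>\<^sub>m 1\<^sub>m m) (T *\<^sub>v v) w = ip (c \<cdot>\<^sub>m 1\<^sub>m n) v (?S *\<^sub>v w)"
    if "v \<in> carrier_vec (dim_col T)" "w \<in> carrier_vec (dim_row T)" for v w
  proof -
    have vw: "v \<in> carrier_vec n" "w \<in> carrier_vec m" using that T by auto
    have "?S *\<^sub>v w = (c' / c) \<cdot>\<^sub>v (mat_adjoint T *\<^sub>v w)"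
      using vw T by (intro smult_mat_mult_vec[where a = n and b = m]) auto
    moreover have "mat_adjoint T *\<^sub>v w \<in> carrier_vec n"
      using T vw by (intro mult_mat_vec_carrier[where n = m]) auto
    ultimately show ?thesis
      using vw T c adj[OF vw] by (simp add: ip_scaled)
  qed
next
  fix S assume S: "S \<in> carrier_mat (dim_col T) (dim_row T) \<and>
    (\<forall>v\<in>carrier_vec (dim_col T). \<forall>w\<in>carrier_vec (dim_row T).
        ip (c' \<cdot>\<^sub>m 1\<^sub>m m) (T *\<^sub>v v) w = ip (c \<cdot>\<^sub>m 1\<^sub>m n) v (S *\<^sub>v w))"
  show "S = ?S"
  proof (rule eq_matI)
    fix i j assume "i < dim_row ?S" "j < dim_col ?S"
    with T have ij: "i < n" "j < m" by auto
    have "ip (c' \<cdot>\<^sub>m 1\<^sub>m m) (T *\<^sub>v unit_vec n i) (unit_vec m j) = c' * cnj (T $$ (j, i))"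
      using T ij by (simp add: ip_scaled scalar_prod_right_unit)
    moreover have "ip (c \<cdot>\<^sub>m 1\<^sub>m n) (unit_vec n i) (S *\<^sub>v unit_vec m j) = c * S $$ (i, j)"
    proof -
      have "conjugate (unit_vec n i) = (unit_vec n i :: complex vec)"
        by (rule eq_vecI) (auto simp: unit_vec_def)
      then show ?thesis using S T ij by (auto simp: ip_scaled)
    qed
    ultimately have "c' * cnj (T $$ (j, i)) = c * S $$ (i, j)"
      using S T ij by auto
    then show "S $$ (i, j) = ?S $$ (i, j)"
      using c ij T by (simp add: field_simps)
  qed (use S T in auto)
qed

section \<open>Multiplication and convolution on matrix algebras\<close>

lemma munit_index:
  "s < n \<Longrightarrow> t < n \<Longrightarrow> j < n \<Longrightarrow> munit n (i * n + j) $$ (s, t) = (if i = s \<and> j = t then 1 else 0)"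
  by (simp add: munit_def product_index_inj)

lemma munit_carrier [simp]: "munit n p \<in> carrier_mat n n"
  by (simp add: munit_def)

lemma mult_map_carrier [simp]: "mult_map n \<in> carrier_mat (n * n) ((n * n) * (n * n))"
  by (simp add: mult_map_def)

lemma mult_map_dim [simp]:
  "dim_row (mult_map n) = n * n" "dim_col (mult_map n) = (n * n) * (n * n)"
  by (simp_all add: mult_map_def)

lemma coords_index: "i < n \<Longrightarrow> j < n \<Longrightarrow> coords n b $ (i * n + j) = b $$ (i, j)"
  using product_index_less[of i n j n] by (simp add: coords_def)

lemma coords_carrier [simp]: "coords n b \<in> carrier_vec (n * n)"
  by (simp add: coords_def)

lemma mult_map_index:
  assumes "s < n" "t < n" "i < n" "k < n" "k' < n" "j < n"
  shows "mult_map n $$ (s * n + t, (i * n + k) * (n * n) + (k' * n + j))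
    = (if s = i \<and> t = j \<and> k = k' then 1 else 0)"
proof -
  have lt: "s * n + t < n * n" "i * n + k < n * n" "k' * n + j < n * n"
    using assms product_index_less by auto
  then have lt2: "(i * n + k) * (n * n) + (k' * n + j) < (n * n) * (n * n)"
    using product_index_less by blast
  have "mult_map n $$ (s * n + t, (i * n + k) * (n * n) + (k' * n + j))
      = (munit n (i * n + k) * munit n (k' * n + j)) $$ (s, t)"
    using assms lt lt2 by (simp add: mult_map_def coords_index)
  also have "\<dots> = (\<Sum>u<n. munit n (i * n + k) $$ (s, u) * munit n (k' * n + j) $$ (u, t))"
    using assms by (intro mat_mult_index) auto
  also have "\<dots> = (\<Sum>u<n. if u = k then (if s = i \<and> t = j \<and> k = k' then 1 else 0) else 0)"
    using assms by (intro sum.cong refl) (auto simp: munit_index)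
  also have "\<dots> = (if s = i \<and> t = j \<and> k = k' then 1 else 0)"
    using assms by simp
  finally show ?thesis .
qed

lemma sum_if_eq_conj:
  fixes f :: "nat \<Rightarrow> 'a :: comm_monoid_add"
  assumes "s < n"
  shows "(\<Sum>i<n. if s = i \<and> Q i then f i else 0) = (if Q s then f s else 0)"
proof -
  have "(\<Sum>i<n. if s = i \<and> Q i then f i else 0) = (\<Sum>i<n. if s = i then if Q i then f i else 0 else 0)"
    by (intro sum.cong) auto
  then show ?thesis using assms by simp
qed

text \<open>The matrix unit \<open>e\<^sub>s\<^sub>t\<close> is hit exactly by the products \<open>e\<^sub>s\<^sub>k * e\<^sub>k\<^sub>t\<close>. With a general \<open>f\<close> this
  evaluates compositions both with the multiplication and with its adjoint.\<close>
lemma sum_mult_map: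
  assumes "s < n" "t < n"
  shows "(\<Sum>x<(n * n) * (n * n). f x * mult_map n $$ (s * n + t, x))
    = (\<Sum>k<n. f ((s * n + k) * (n * n) + (k * n + t)))"
proof -
  have "(\<Sum>x<(n * n) * (n * n). f x * mult_map n $$ (s * n + t, x))
      = (\<Sum>i<n. \<Sum>k<n. \<Sum>k'<n. \<Sum>j<n. f ((i * n + k) * (n * n) + (k' * n + j))
           * mult_map n $$ (s * n + t, (i * n + k) * (n * n) + (k' * n + j)))"
    by (simp only: sum_product_index)
  also have "\<dots> = (\<Sum>i<n. \<Sum>k<n. \<Sum>k'<n. \<Sum>j<n.
      if t = j \<and> (s = i \<and> k = k') then f ((i * n + k) * (n * n) + (k' * n + j)) else 0)"
    using assms by (intro sum.cong refl) (auto simp: mult_map_index)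
  also have "\<dots> = (\<Sum>i<n. \<Sum>k<n. \<Sum>k'<n.
      if k = k' \<and> s = i then f ((i * n + k) * (n * n) + (k' * n + t)) else 0)"
    using assms by (intro sum.cong refl) (simp add: sum_if_eq_conj conj_commute)
  also have "\<dots> = (\<Sum>k<n. \<Sum>i<n. if s = i \<and> True then f ((i * n + k) * (n * n) + (k * n + t)) else 0)"
    by (subst sum.swap, intro sum.cong refl) (simp add: sum_if_eq_conj)
  also have "\<dots> = (\<Sum>k<n. f ((s * n + k) * (n * n) + (k * n + t)))"
    using assms(1) by (subst sum_if_eq_conj) auto
  finally show ?thesis .
qed

lemma mult_map_adjoint_index:
  "s < n \<Longrightarrow> t < n \<Longrightarrow> x < (n * n) * (n * n) \<Longrightarrow>
    mat_adjoint (mult_map n) $$ (x, s * n + t) = mult_map n $$ (s * n + t, x)"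
proof -
  assume *: "s < n" "t < n" "x < (n * n) * (n * n)"
  then obtain p q where pq: "p < n * n" "q < n * n" "x = p * (n * n) + q"
    by (meson index_product_split)
  from pq obtain i k where ik: "i < n" "k < n" "p = i * n + k"
    by (meson index_product_split)
  from pq obtain k' j where k'j: "k' < n" "j < n" "q = k' * n + j"
    by (meson index_product_split)
  have "s * n + t < dim_row (mult_map n)" "x < dim_col (mult_map n)"
    using * product_index_less by (auto simp: mult_map_def)
  then have "mat_adjoint (mult_map n) $$ (x, s * n + t) = cnj (mult_map n $$ (s * n + t, x))"
    by simp
  then show ?thesis
    using * ik k'j unfolding pq by (simp add: mult_map_index)
qed

text \<open>The right-hand side is the product of the Choi matrices, whose entry at \<open>((s, i), (t, j))\<close> is
  the entry of the operator at \<open>((s, t), (i, j))\<close>. This turns quantum graphs into ordinary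
  idempotents.\<close>
lemma convolution_index:
  assumes A: "A \<in> carrier_mat (n * n) (n * n)" and B: "B \<in> carrier_mat (n * n) (n * n)"
    and "s < n" "t < n" "i < n" "j < n"
  shows "(mult_map n * kron A B * mat_adjoint (mult_map n)) $$ (s * n + t, i * n + j)
    = (\<Sum>k<n. \<Sum>u<n. A $$ (s * n + u, i * n + k) * B $$ (u * n + t, k * n + j))"
proof -
  let ?N = "(n * n) * (n * n)"
  have lt: "s * n + t < n * n" "i * n + j < n * n"
    using assms product_index_less by auto
  have K: "kron A B \<in> carrier_mat ?N ?N" using A B by auto
  have "(mult_map n * kron A B * mat_adjoint (mult_map n)) $$ (s * n + t, i * n + j)
      = (\<Sum>y<?N. (mult_map n * kron A B) $$ (s * n + t, y) * mult_map n $$ (i * n + j, y))"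
    using mat_mult_index[OF mult_carrier_mat[OF mult_map_carrier K]
        mat_adjoint_carrier[OF mult_map_carrier] lt] assms
    by (simp add: mult_map_adjoint_index)
  also have "\<dots> = (\<Sum>k<n. (mult_map n * kron A B) $$ (s * n + t, (i * n + k) * (n * n) + (k * n + j)))"
    using assms by (simp only: sum_mult_map)
  also have "\<dots> = (\<Sum>k<n. \<Sum>u<n. A $$ (s * n + u, i * n + k) * B $$ (u * n + t, k * n + j))"
  proof (rule sum.cong[OF refl])
    fix k assume "k \<in> {..<n}"
    then have k: "k < n" by simp
    have pq: "i * n + k < n * n" "k * n + j < n * n"
      using k assms product_index_less by auto
    then have "(i * n + k) * (n * n) + (k * n + j) < ?N" (is "?c < _")
      using product_index_less by blast
    then have "(mult_map n * kron A B) $$ (s * n + t, ?c)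
        = (\<Sum>x<?N. kron A B $$ (x, ?c) * mult_map n $$ (s * n + t, x))"
      using mat_mult_index[OF mult_map_carrier K lt(1)] by (simp add: mult.commute)
    also have "\<dots> = (\<Sum>u<n. kron A B $$ ((s * n + u) * (n * n) + (u * n + t), ?c))"
      using assms by (simp only: sum_mult_map)
    also have "\<dots> = (\<Sum>u<n. A $$ (s * n + u, i * n + k) * B $$ (u * n + t, k * n + j))"
      using assms pq product_index_less by (intro sum.cong refl kron_index[OF A B]) auto
    finally show "(mult_map n * kron A B) $$ (s * n + t, ?c)
      = (\<Sum>u<n. A $$ (s * n + u, i * n + k) * B $$ (u * n + t, k * n + j))" .
  qed
  finally show ?thesis .
qed

lemma apply_op_index:
  assumes "A \<in> carrier_mat (n * n) (n * n)" "s < n" "t < n"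
  shows "apply_op n A b $$ (s, t) = (\<Sum>i<n. \<Sum>j<n. A $$ (s * n + t, i * n + j) * b $$ (i, j))"
proof -
  have "apply_op n A b $$ (s, t) = (A *\<^sub>v coords n b) $ (s * n + t)"
    using assms by (simp add: apply_op_def of_coords_def)
  also have "\<dots> = (\<Sum>p<n * n. A $$ (s * n + t, p) * coords n b $ p)"
    using assms product_index_less by (intro mult_mat_vec_index) auto
  also have "\<dots> = (\<Sum>i<n. \<Sum>j<n. A $$ (s * n + t, i * n + j) * b $$ (i, j))"
    by (simp add: sum_product_index coords_index)
  finally show ?thesis .
qed

lemma apply_op_carrier [simp]: "apply_op n A b \<in> carrier_mat n n"
  by (simp add: apply_op_def of_coords_def)

lemma apply_op_dim [simp]: "dim_row (apply_op n A b) = n" "dim_col (apply_op n A b) = n"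
  by (simp_all add: apply_op_def of_coords_def)

lemma apply_op_munit:
  assumes "A \<in> carrier_mat (n * n) (n * n)" "s < n" "t < n" "i < n" "j < n"
  shows "apply_op n A (munit n (i * n + j)) $$ (s, t) = A $$ (s * n + t, i * n + j)"
proof -
  have "apply_op n A (munit n (i * n + j)) $$ (s, t)
      = (\<Sum>k<n. \<Sum>l<n. if j = l \<and> i = k then A $$ (s * n + t, k * n + l) else 0)"
    using assms unfolding apply_op_index[OF assms(1-3)]
    by (intro sum.cong refl) (auto simp: munit_index)
  also have "\<dots> = (\<Sum>k<n. if i = k \<and> True then A $$ (s * n + t, k * n + j) else 0)"
    using assms by (simp add: sum_if_eq_conj)
  also have "\<dots> = A $$ (s * n + t, i * n + j)"
    using assms by (subst sum_if_eq_conj) auto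
  finally show ?thesis .
qed

text \<open>Reality is Hermiticity of the Choi matrix. It can be tested on the matrix units because both
  sides of \<open>A(b\<^sup>*) = A(b)\<^sup>*\<close> are conjugate linear in \<open>b\<close>.\<close>
lemma real_graph_iff:
  assumes A: "A \<in> carrier_mat (n * n) (n * n)"
  shows "real_graph n A \<longleftrightarrow> (\<forall>s<n. \<forall>t<n. \<forall>i<n. \<forall>j<n.
    A $$ (s * n + t, i * n + j) = cnj (A $$ (t * n + s, j * n + i)))"
proof
  assume r: "real_graph n A"
  show "\<forall>s<n. \<forall>t<n. \<forall>i<n. \<forall>j<n. A $$ (s * n + t, i * n + j) = cnj (A $$ (t * n + s, j * n + i))"
  proof (intro allI impI)
    fix s t i j assume lt: "s < n" "t < n" "i < n" "j < n"
    have "mat_adjoint (munit n (j * n + i)) = munit n (i * n + j)"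
    proof (rule eq_matI)
      fix k l assume "k < dim_row (munit n (i * n + j))" "l < dim_col (munit n (i * n + j))"
      then have kl: "k < n" "l < n" by (simp_all add: munit_def)
      then have "mat_adjoint (munit n (j * n + i)) $$ (k, l) = cnj (munit n (j * n + i) $$ (l, k))"
        by (intro mat_adjoint_index) (simp_all add: munit_def)
      then show "mat_adjoint (munit n (j * n + i)) $$ (k, l) = munit n (i * n + j) $$ (k, l)"
        using lt kl by (simp add: munit_index conj_commute)
    qed (auto simp: munit_def)
    then have "apply_op n A (munit n (i * n + j)) = mat_adjoint (apply_op n A (munit n (j * n + i)))"
      using r unfolding real_graph_def by (metis munit_carrier)
    then have "apply_op n A (munit n (i * n + j)) $$ (s, t)
        = mat_adjoint (apply_op n A (munit n (j * n + i))) $$ (s, t)" by simp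
    also have "\<dots> = cnj (apply_op n A (munit n (j * n + i)) $$ (t, s))"
      using lt apply_op_carrier[of n A "munit n (j * n + i)"] by (intro mat_adjoint_index) auto
    finally show "A $$ (s * n + t, i * n + j) = cnj (A $$ (t * n + s, j * n + i))"
      using lt by (simp add: apply_op_munit[OF A])
  qed
next
  assume *: "\<forall>s<n. \<forall>t<n. \<forall>i<n. \<forall>j<n. A $$ (s * n + t, i * n + j) = cnj (A $$ (t * n + s, j * n + i))"
  show "real_graph n A"
    unfolding real_graph_def
  proof (intro ballI eq_matI)
    fix b s t assume b: "b \<in> carrier_mat n n" and
      "s < dim_row (mat_adjoint (apply_op n A b))" "t < dim_col (mat_adjoint (apply_op n A b))"
    then have st: "s < n" "t < n" by auto
    have "apply_op n A (mat_adjoint b) $$ (s, t)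
        = (\<Sum>i<n. \<Sum>j<n. cnj (A $$ (t * n + s, j * n + i) * b $$ (j, i)))"
      unfolding apply_op_index[OF A st]
    proof (intro sum.cong refl)
      fix i j assume "i \<in> {..<n}" "j \<in> {..<n}"
      moreover from this have "A $$ (s * n + t, i * n + j) = cnj (A $$ (t * n + s, j * n + i))"
        using * st unfolding lessThan_iff by blast
      ultimately show "A $$ (s * n + t, i * n + j) * mat_adjoint b $$ (i, j)
          = cnj (A $$ (t * n + s, j * n + i) * b $$ (j, i))"
        using b by simp
    qed
    also have "\<dots> = (\<Sum>j<n. \<Sum>i<n. cnj (A $$ (t * n + s, j * n + i) * b $$ (j, i)))"
      by (rule sum.swap)
    also have "\<dots> = cnj (apply_op n A b $$ (t, s))"
      by (simp add: apply_op_index[OF A st(2,1)])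
    also have "\<dots> = mat_adjoint (apply_op n A b) $$ (s, t)"
      using st by (intro mat_adjoint_index[symmetric]) auto
    finally show "apply_op n A (mat_adjoint b) $$ (s, t) = mat_adjoint (apply_op n A b) $$ (s, t)" .
  qed auto
qed

section \<open>Quantum graphs for the normalised trace\<close>

lemma sum_lessThan_2: "(\<Sum>u<2. f u) = f 0 + f (1 :: nat)"
  by (simp add: numeral_2_eq_2)

lemma gram_tau: "gram 2 tau = (1 / 2) \<cdot>\<^sub>m 1\<^sub>m 4"
proof (rule eq_matI)
  fix p q assume "p < dim_row ((1 / 2 :: complex) \<cdot>\<^sub>m 1\<^sub>m 4)" "q < dim_col ((1 / 2 :: complex) \<cdot>\<^sub>m 1\<^sub>m 4)"
  then have "p < 2 * 2" "q < 2 * 2" by auto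
  then obtain i j k l where ij: "i < 2" "j < 2" "p = i * 2 + j" and kl: "k < 2" "l < 2" "q = k * 2 + l"
    by (meson index_product_split)
  have "(mat_adjoint (munit 2 p) * munit 2 q) $$ (r, r)
      = (if j = r \<and> l = r \<and> i = k then 1 else 0)" if "r < 2" for r
  proof -
    have "(mat_adjoint (munit 2 p) * munit 2 q) $$ (r, r)
        = (\<Sum>u<2. mat_adjoint (munit 2 p) $$ (r, u) * munit 2 q $$ (u, r))"
      using that by (intro mat_mult_index) auto
    also have "\<dots> = (\<Sum>u<2. cnj (munit 2 p $$ (u, r)) * munit 2 q $$ (u, r))"
      using that by (intro sum.cong refl) (auto simp: munit_def)
    also have "\<dots> = (if j = r \<and> l = r \<and> i = k then 1 else 0)"
      using that ij(1,2) kl(1,2) unfolding ij(3) kl(3) sum_lessThan_2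
      by (auto simp: munit_index less_2_cases_iff)
    finally show ?thesis .
  qed
  then have "gram 2 tau $$ (p, q) = (if i = k \<and> j = l then 1 / 2 else 0)"
    using \<open>p < 2 * 2\<close> \<open>q < 2 * 2\<close> ij(1,2) kl(1,2)
    by (auto simp: gram_def tau_def less_2_cases_iff)
  then show "gram 2 tau $$ (p, q) = ((1 / 2) \<cdot>\<^sub>m 1\<^sub>m 4) $$ (p, q)"
    using \<open>p < 2 * 2\<close> \<open>q < 2 * 2\<close> ij(1,2) kl(1,2) by (simp add: product_index_inj ij(3) kl(3))
qed (simp_all add: gram_def)

lemma comult_map_tau: "comult_map 2 tau = 2 \<cdot>\<^sub>m mat_adjoint (mult_map 2)"
  using hadjoint_scaled[of "mult_map 2" 4 16 "1 / 4" "1 / 2"] mult_map_carrier[of 2]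
  by (simp add: comult_map_def gram_tau kron_scaled kron_one_one)

lemma hadjoint_tau:
  assumes "A \<in> carrier_mat 4 4"
  shows "hadjoint (gram 2 tau) (gram 2 tau) A = mat_adjoint A"
proof -
  have "1 \<cdot>\<^sub>m mat_adjoint A = mat_adjoint A" by (rule eq_matI) auto
  then show ?thesis
    using hadjoint_scaled[OF assms, of "1 / 2" "1 / 2"] by (simp add: gram_tau)
qed

lemma convolution_tau:
  assumes A: "A \<in> carrier_mat 4 4" and B: "B \<in> carrier_mat 4 4"
    and "s < 2" "t < 2" "i < 2" "j < 2"
  shows "(mult_map 2 * kron A B * comult_map 2 tau) $$ (s * 2 + t, i * 2 + j)
    = 2 * (\<Sum>k<2. \<Sum>u<2. A $$ (s * 2 + u, i * 2 + k) * B $$ (u * 2 + t, k * 2 + j))"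
proof -
  have K: "mult_map 2 * kron A B \<in> carrier_mat 4 16"
    using A B mult_map_carrier[of 2] by auto
  have J: "mat_adjoint (mult_map 2) \<in> carrier_mat 16 4"
    using mult_map_carrier[of 2] by auto
  have "s * 2 + t < 4" "i * 2 + j < 4"
    using assms by linarith+
  then have "(2 \<cdot>\<^sub>m (mult_map 2 * kron A B * mat_adjoint (mult_map 2))) $$ (s * 2 + t, i * 2 + j)
      = 2 * (mult_map 2 * kron A B * mat_adjoint (mult_map 2)) $$ (s * 2 + t, i * 2 + j)"
    using K J by (intro index_smult_mat) auto
  then show ?thesis
    using K J convolution_index[of A 2 B s t i j] assms
    by (simp add: comult_map_tau mult_smult_distrib[OF K J])
qed

lemma less_4_iff: "(i :: nat) < 4 \<longleftrightarrow> i = 0 \<or> i = 1 \<or> i = 2 \<or> i = 3"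
  by auto

text \<open>Indices below four are kept in the split form \<open>s * 2 + t\<close>, in which the entries of tensor
  products and convolutions are known.\<close>
lemma mat_4_eq_iff:
  assumes "X \<in> carrier_mat 4 4" "Y \<in> carrier_mat 4 4"
  shows "X = Y \<longleftrightarrow> (\<forall>s<2. \<forall>t<2. \<forall>i<2. \<forall>j<2. X $$ (s * 2 + t, i * 2 + j) = Y $$ (s * 2 + t, i * 2 + j))"
proof
  assume *: "\<forall>s<2. \<forall>t<2. \<forall>i<2. \<forall>j<2. X $$ (s * 2 + t, i * 2 + j) = Y $$ (s * 2 + t, i * 2 + j)"
  show "X = Y"
  proof (rule eq_matI)
    fix p q assume "p < dim_row Y" "q < dim_col Y"
    then have "p < 2 * 2" "q < 2 * 2" using assms by auto
    then obtain s t i j where "s < 2" "t < 2" "p = s * 2 + t" "i < 2" "j < 2" "q = i * 2 + j"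
      by (meson index_product_split)
    then show "X $$ (p, q) = Y $$ (p, q)" using * by auto
  qed (use assms in auto)
qed simp

lemma faithful_state_tau: "faithful_state 2 tau"
proof -
  have pos: "tau (mat_adjoint x * x) = of_real ((\<Sum>i<2. \<Sum>k<2. (cmod (x $$ (k, i)))\<^sup>2) / 2)"
    if x: "x \<in> carrier_mat 2 2" for x
  proof -
    have "(mat_adjoint x * x) $$ (i, i) = (\<Sum>k<2. of_real ((cmod (x $$ (k, i)))\<^sup>2))" if "i < 2" for i
      using x that
      by (subst mat_mult_index[of _ 2 2 _ 2]) (auto simp: complex_norm_square mult.commute simp del: of_real_power)
    then show ?thesis by (simp add: tau_def sum_lessThan_2)
  qed
  have "x = 0\<^sub>m 2 2" if x: "x \<in> carrier_mat 2 2" and 0: "tau (mat_adjoint x * x) = 0" for x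
  proof -
    have "(\<Sum>i<2. \<Sum>k<2. (cmod (x $$ (k, i)))\<^sup>2) = 0"
      using 0 unfolding pos[OF x] of_real_eq_0_iff by simp
    then have "\<forall>i<2. \<forall>k<2. x $$ (k, i) = 0"
      by (simp add: sum_nonneg_eq_0_iff sum_nonneg)
    then show ?thesis using x by (intro eq_matI) auto
  qed
  moreover have "Re (tau (mat_adjoint x * x)) \<ge> 0" "Im (tau (mat_adjoint x * x)) = 0"
    if "x \<in> carrier_mat 2 2" for x
    unfolding pos[OF that] Re_complex_of_real Im_complex_of_real by (simp_all add: sum_nonneg)
  moreover have "tau (c \<cdot>\<^sub>m x) = c * tau x" if "x \<in> carrier_mat 2 2" for c x
    using that by (simp add: tau_def distrib_left)
  moreover have "tau (x + y) = tau x + tau y" if "x \<in> carrier_mat 2 2" "y \<in> carrier_mat 2 2" for x y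
    using that by (simp add: tau_def add_divide_distrib)
  moreover have "tau (1\<^sub>m 2) = 1" by (simp add: tau_def)
  ultimately show ?thesis unfolding faithful_state_def by auto
qed

lemma quantum_set_tau: "quantum_set 2 tau 2"
proof -
  have carr: "mult_map 2 * comult_map 2 tau \<in> carrier_mat 4 4"
    using mult_map_carrier[of 2] by (auto simp: comult_map_tau)
  have one: "mult_map 2 * kron (1\<^sub>m 4) (1\<^sub>m 4) = mult_map 2"
    using mult_map_carrier[of 2] by (simp add: kron_one_one)
  have "mult_map 2 * comult_map 2 tau = 4 \<cdot>\<^sub>m 1\<^sub>m 4"
    using convolution_tau[of "1\<^sub>m 4" "1\<^sub>m 4"] carr
    unfolding one
    by (subst mat_4_eq_iff) (auto simp: less_2_cases_iff sum_lessThan_2)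
  then show ?thesis
    using faithful_state_tau by (simp add: quantum_set_def power2_eq_square)
qed

lemma quantum_graph_tau_iff:
  "quantum_graph 2 tau 2 A \<longleftrightarrow> A \<in> carrier_mat 4 4 \<and> (\<forall>s<2. \<forall>t<2. \<forall>i<2. \<forall>j<2.
    (\<Sum>k<2. \<Sum>u<2. A $$ (s * 2 + u, i * 2 + k) * A $$ (u * 2 + t, k * 2 + j))
      = 2 * A $$ (s * 2 + t, i * 2 + j))"
proof (cases "A \<in> carrier_mat 4 4")
  case A: True
  let ?M = "mult_map 2 * kron A A * comult_map 2 tau"
  have M: "?M \<in> carrier_mat 4 4"
    using A mult_map_carrier[of 2] by (auto simp: comult_map_tau)
  have N: "4 \<cdot>\<^sub>m A \<in> carrier_mat 4 4" using A by simp
  have entry: "?M $$ (s * 2 + t, i * 2 + j) = (4 \<cdot>\<^sub>m A) $$ (s * 2 + t, i * 2 + j) \<longleftrightarrow>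
      (\<Sum>k<2. \<Sum>u<2. A $$ (s * 2 + u, i * 2 + k) * A $$ (u * 2 + t, k * 2 + j))
        = 2 * A $$ (s * 2 + t, i * 2 + j)" if "s < 2" "t < 2" "i < 2" "j < 2" for s t i j
  proof -
    have "s * 2 + t < 4" "i * 2 + j < 4" using that by linarith+
    then have *: "(4 \<cdot>\<^sub>m A) $$ (s * 2 + t, i * 2 + j) = 2 * (2 * A $$ (s * 2 + t, i * 2 + j))"
      using A by simp
    show ?thesis unfolding * convolution_tau[OF A A that] by (subst mult_left_cancel) auto
  qed
  then have "?M = 4 \<cdot>\<^sub>m A \<longleftrightarrow> (\<forall>s<2. \<forall>t<2. \<forall>i<2. \<forall>j<2.
      (\<Sum>k<2. \<Sum>u<2. A $$ (s * 2 + u, i * 2 + k) * A $$ (u * 2 + t, k * 2 + j))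
        = 2 * A $$ (s * 2 + t, i * 2 + j))"
    unfolding mat_4_eq_iff[OF M N] by (intro all_cong entry)
  then show ?thesis
    using A quantum_set_tau by (simp add: quantum_graph_def)
qed (simp add: quantum_graph_def)

lemma reflexive_graph_tau_iff:
  assumes A: "A \<in> carrier_mat 4 4"
  shows "reflexive_graph 2 tau 2 A \<longleftrightarrow>
    (\<forall>s<2. \<forall>i<2. (\<Sum>k<2. A $$ (s * 2 + k, i * 2 + k)) = (if s = i then 2 else 0))"
proof -
  let ?M = "mult_map 2 * kron A (1\<^sub>m 4) * comult_map 2 tau"
  have M: "?M \<in> carrier_mat 4 4" and N: "4 \<cdot>\<^sub>m 1\<^sub>m 4 \<in> (carrier_mat 4 4 :: complex mat set)"
    using A mult_map_carrier[of 2] by (auto simp: comult_map_tau)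
  have entry: "?M $$ (s * 2 + t, i * 2 + j) = (4 \<cdot>\<^sub>m 1\<^sub>m 4) $$ (s * 2 + t, i * 2 + j) \<longleftrightarrow>
      (t = j \<longrightarrow> (\<Sum>k<2. A $$ (s * 2 + k, i * 2 + k)) = (if s = i then 2 else 0))"
    if "s < 2" "t < 2" "i < 2" "j < 2" for s t i j
  proof -
    have lt: "s * 2 + t < 4" "i * 2 + j < 4" using that by linarith+
    have one: "1\<^sub>m 4 $$ (u * 2 + t, k * 2 + j) = (if k = u \<and> t = j then 1 else 0 :: complex)"
      if "u < 2" "k < 2" for u k
    proof -
      have "u * 2 + t < 4" "k * 2 + j < 4" using that \<open>t < 2\<close> \<open>j < 2\<close> by linarith+
      then show ?thesis using product_index_inj[OF \<open>t < 2\<close> \<open>j < 2\<close>] by auto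
    qed
    have "(\<Sum>k<2. \<Sum>u<2. A $$ (s * 2 + u, i * 2 + k) * 1\<^sub>m 4 $$ (u * 2 + t, k * 2 + j))
        = (if t = j then (\<Sum>k<2. A $$ (s * 2 + k, i * 2 + k)) else 0)"
      by (simp add: sum_lessThan_2 one)
    moreover have "(4 \<cdot>\<^sub>m 1\<^sub>m 4) $$ (s * 2 + t, i * 2 + j) = (if s = i \<and> t = j then 2 * 2 else 0 :: complex)"
      using lt product_index_inj[OF \<open>t < 2\<close> \<open>j < 2\<close>] by simp
    ultimately show ?thesis
      unfolding convolution_tau[OF A one_carrier_mat that] by auto
  qed
  have diag: "(\<forall>s<2. \<forall>t<2. \<forall>i<2. \<forall>j<2. t = (j :: nat) \<longrightarrow> Q s i) = (\<forall>s<2. \<forall>i<2. Q s i)"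
    for Q :: "nat \<Rightarrow> nat \<Rightarrow> bool"
    using pos2 by blast
  have "?M = 4 \<cdot>\<^sub>m 1\<^sub>m 4 \<longleftrightarrow> (\<forall>s<2. \<forall>t<2. \<forall>i<2. \<forall>j<2.
      t = (j :: nat) \<longrightarrow> (\<Sum>k<2. A $$ (s * 2 + k, i * 2 + k)) = (if s = i then 2 else 0))"
    unfolding mat_4_eq_iff[OF M N] by (intro all_cong entry)
  also have "\<dots> = (\<forall>s<2. \<forall>i<2. (\<Sum>k<2. A $$ (s * 2 + k, i * 2 + k)) = (if s = i then 2 else 0))"
    using diag by simp
  finally show ?thesis
    by (simp add: reflexive_graph_def)
qed

lemma undirected_graph_tau_iff:
  assumes A: "A \<in> carrier_mat 4 4"
  shows "undirected_graph 2 tau A \<longleftrightarrow> (\<forall>s<2. \<forall>t<2. \<forall>i<2. \<forall>j<2.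
    A $$ (s * 2 + t, i * 2 + j) = cnj (A $$ (t * 2 + s, j * 2 + i)) \<and>
    A $$ (s * 2 + t, i * 2 + j) = cnj (A $$ (i * 2 + j, s * 2 + t)))"
proof -
  have entry: "mat_adjoint A $$ (s * 2 + t, i * 2 + j) = A $$ (s * 2 + t, i * 2 + j) \<longleftrightarrow>
      A $$ (s * 2 + t, i * 2 + j) = cnj (A $$ (i * 2 + j, s * 2 + t))"
    if "s < 2" "t < 2" "i < 2" "j < 2" for s t i j
  proof -
    have "s * 2 + t < 4" "i * 2 + j < 4" using that by linarith+
    then show ?thesis using A by auto
  qed
  have adj: "mat_adjoint A = A \<longleftrightarrow> (\<forall>s<2. \<forall>t<2. \<forall>i<2. \<forall>j<2.
      A $$ (s * 2 + t, i * 2 + j) = cnj (A $$ (i * 2 + j, s * 2 + t)))"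
    unfolding mat_4_eq_iff[OF mat_adjoint_carrier[OF A] A] by (intro all_cong entry)
  have "(4 :: nat) = 2 * 2" by simp
  then show ?thesis
    unfolding undirected_graph_def hadjoint_tau[OF A] adj real_graph_iff[of A 2, folded \<open>4 = 2 * 2\<close>, OF A]
    by blast
qed

section \<open>Real symmetric projections of size three\<close>

text \<open>Here and below, \<open>a, b, c\<close> is the diagonal of a symmetric \<open>Q\<close>, and \<open>x = Q\<^sub>1\<^sub>2\<close>, \<open>y = Q\<^sub>1\<^sub>3\<close>,
  \<open>z = Q\<^sub>2\<^sub>3\<close>; the six hypotheses say \<open>Q\<^sup>2 = Q\<close>. By the Cayley-Hamilton theorem
  \<open>adj Q = Q\<^sup>2 - t Q + e = (1 - t) Q + e\<close>, where \<open>t\<close> is the trace and \<open>e = (t\<^sup>2 - t) / 2\<close> the sum of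
  the principal minors.\<close>
lemma projection_3_cofactors:
  fixes a b c x y z :: real
  assumes "a * a + x * x + y * y = a" "x * x + b * b + z * z = b" "y * y + z * z + c * c = c"
    "a * x + x * b + y * z = x" "a * y + x * z + y * c = y" "x * y + b * z + z * c = z"
  defines "t \<equiv> a + b + c"
  shows "y * z - x * c = x * (1 - t)" "x * z - y * b = y * (1 - t)" "x * y - z * a = z * (1 - t)"
    "2 * (b * c - z * z) = 2 * (1 - t) * a + (t * t - t)"
    "2 * (a * c - y * y) = 2 * (1 - t) * b + (t * t - t)"
    "2 * (a * b - x * x) = 2 * (1 - t) * c + (t * t - t)"
  using assms(1-6) unfolding t_def by (simp_all only: algebra_simps)

text \<open>Multiplying \<open>adj Q = (1 - t) Q + e\<close> by \<open>Q\<close> gives \<open>(1 - t + e) Q = det Q\<close>, and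
  \<open>2 (1 - t + e) = (t - 1) (t - 2)\<close>. So \<open>Q\<close> is scalar, hence \<open>0\<close> or \<open>1\<close>, unless \<open>t\<close> is \<open>1\<close> or
  \<open>2\<close>.\<close>
lemma projection_3_trace:
  fixes a b c x y z :: real
  assumes Q: "a * a + x * x + y * y = a" "x * x + b * b + z * z = b" "y * y + z * z + c * c = c"
    "a * x + x * b + y * z = x" "a * y + x * z + y * c = y" "x * y + b * z + z * c = z"
  obtains "a = 0" "b = 0" "c = 0" "x = 0" "y = 0" "z = 0"
  | "a = 1" "b = 1" "c = 1" "x = 0" "y = 0" "z = 0"
  | "a + b + c = 1" | "a + b + c = 2"
proof -
  define t where "t = a + b + c"
  define k where "k = (t - 1) * (t - 2)"
  note C = projection_3_cofactors[OF Q, folded t_def]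
  have k: "k * u = 2 * (1 - t) * u + (t * t - t) * u" for u
    unfolding k_def by (simp add: algebra_simps)
  have kx: "k * x = 0"
  proof -
    have "k * x = 2 * (1 - t) * (a * x + x * b + y * z) + (t * t - t) * x"
      unfolding k Q(4) ..
    also have "\<dots> = 2 * a * (x * (1 - t)) + x * (2 * (1 - t) * b + (t * t - t)) + 2 * y * (z * (1 - t))"
      by (simp add: algebra_simps)
    also have "\<dots> = 0"
      unfolding C[symmetric] by (simp add: algebra_simps)
    finally show ?thesis .
  qed
  have ky: "k * y = 0"
  proof -
    have "k * y = 2 * (1 - t) * (a * y + x * z + y * c) + (t * t - t) * y"
      unfolding k Q(5) ..
    also have "\<dots> = 2 * a * (y * (1 - t)) + 2 * x * (z * (1 - t)) + y * (2 * (1 - t) * c + (t * t - t))"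
      by (simp add: algebra_simps)
    also have "\<dots> = 0"
      unfolding C[symmetric] by (simp add: algebra_simps)
    finally show ?thesis .
  qed
  have kz: "k * z = 0"
  proof -
    have "k * z = 2 * (1 - t) * (x * y + b * z + z * c) + (t * t - t) * z"
      unfolding k Q(6) ..
    also have "\<dots> = 2 * x * (y * (1 - t)) + 2 * b * (z * (1 - t)) + z * (2 * (1 - t) * c + (t * t - t))"
      by (simp add: algebra_simps)
    also have "\<dots> = 0"
      unfolding C[symmetric] by (simp add: algebra_simps)
    finally show ?thesis .
  qed
  have ka: "k * a = d" and kb: "k * b = d" and kc: "k * c = d"
    if "d = 2 * (a * b * c + 2 * x * y * z - a * z * z - b * y * y - c * x * x)" for d
  proof -
    have "k * a = 2 * (1 - t) * (a * a + x * x + y * y) + (t * t - t) * a"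
      unfolding k Q(1) ..
    also have "\<dots> = a * (2 * (1 - t) * a + (t * t - t)) + 2 * x * (x * (1 - t)) + 2 * y * (y * (1 - t))"
      by (simp add: algebra_simps)
    also have "\<dots> = d"
      unfolding C[symmetric] that by (simp add: algebra_simps)
    finally show "k * a = d" .
    have "k * b = 2 * (1 - t) * (x * x + b * b + z * z) + (t * t - t) * b"
      unfolding k Q(2) ..
    also have "\<dots> = 2 * x * (x * (1 - t)) + b * (2 * (1 - t) * b + (t * t - t)) + 2 * z * (z * (1 - t))"
      by (simp add: algebra_simps)
    also have "\<dots> = d"
      unfolding C[symmetric] that by (simp add: algebra_simps)
    finally show "k * b = d" .
    have "k * c = 2 * (1 - t) * (y * y + z * z + c * c) + (t * t - t) * c"
      unfolding k Q(3) ..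
    also have "\<dots> = 2 * y * (y * (1 - t)) + 2 * z * (z * (1 - t)) + c * (2 * (1 - t) * c + (t * t - t))"
      by (simp add: algebra_simps)
    also have "\<dots> = d"
      unfolding C[symmetric] that by (simp add: algebra_simps)
    finally show "k * c = d" .
  qed
  show ?thesis
  proof (cases "k = 0")
    case True
    then show ?thesis using that(3,4) by (auto simp: k_def t_def)
  next
    case False
    with kx ky kz ka kb kc have eq: "x = 0" "y = 0" "z = 0" "b = a" "c = a"
      by (metis mult_eq_0_iff mult_left_cancel)+
    with Q(1) have "a = 0 \<or> a = 1" by auto
    then show ?thesis using that(1,2) eq by auto
  qed
qed

text \<open>For trace \<open>1\<close> all cofactors vanish, so \<open>Q\<close> has rank one and a nonzero column, divided by the
  root of its diagonal entry, serves as \<open>n\<close>.\<close>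
lemma projection_3_rank_one:
  fixes a b c x y z :: real
  assumes Q: "a * a + x * x + y * y = a" "x * x + b * b + z * z = b" "y * y + z * z + c * c = c"
    "a * x + x * b + y * z = x" "a * y + x * z + y * c = y" "x * y + b * z + z * c = z"
    and t: "a + b + c = 1"
  obtains n1 n2 n3 :: real where "n1 * n1 + n2 * n2 + n3 * n3 = 1"
    "a = n1 * n1" "b = n2 * n2" "c = n3 * n3" "x = n1 * n2" "y = n1 * n3" "z = n2 * n3"
proof -
  have minors: "x * x = a * b" "y * y = a * c" "z * z = b * c" "x * c = y * z" "y * b = x * z" "z * a = x * y"
    using projection_3_cofactors[OF Q] by (simp_all add: t)
  have nonneg: "a \<ge> 0" "b \<ge> 0" "c \<ge> 0"
    using Q(1-3) by (metis add_nonneg_nonneg zero_le_square)+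
  show ?thesis
  proof (cases "a = 0")
    case False
    with nonneg have a: "a > 0" by simp
    define s where "s = sqrt a"
    have s: "s * s = a" "s \<noteq> 0" using a by (auto simp: s_def)
    have "b = (x / s) * (x / s)" "c = (y / s) * (y / s)" "z = (x / s) * (y / s)"
      using minors a s by (simp_all add: field_simps)
    moreover have "x = s * (x / s)" "y = s * (y / s)" using s by simp_all
    ultimately show ?thesis
      using that[of s "x / s" "y / s"] s(1) t by metis
  next
    case a: True
    then have xy: "x = 0" "y = 0" using minors by auto
    show ?thesis
    proof (cases "b = 0")
      case False
      with nonneg have b: "b > 0" by simp
      define s where "s = sqrt b"
      have s: "s * s = b" "s \<noteq> 0" using b by (auto simp: s_def)
      have c: "c = (z / s) * (z / s)"
        using minors b s by (simp add: field_simps)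
      then have "0 * 0 + s * s + (z / s) * (z / s) = 1"
        using s(1) t a by simp
      from that[OF this] show ?thesis
        using s a xy c by simp
    next
      case True
      with a t minors have "c = 1" "z = 0" by auto
      then show ?thesis using that[of 0 0 1] True a xy by simp
    qed
  qed
qed

section \<open>Undirected reflexive graphs in Pauli coordinates\<close>

text \<open>The matrix of \<open>b \<mapsto> b + (\<Sum>k l. Q\<^sub>k\<^sub>l \<cdot> (\<sigma>\<^sub>k * b * \<sigma>\<^sub>l))\<close>, where \<open>\<sigma>\<^sub>1, \<sigma>\<^sub>2, \<sigma>\<^sub>3\<close> are the Pauli
  matrices and \<open>Q\<close> is the real symmetric matrix with diagonal \<open>a, b, c\<close> and upper entries
  \<open>x = Q\<^sub>1\<^sub>2\<close>, \<open>y = Q\<^sub>1\<^sub>3\<close>, \<open>z = Q\<^sub>2\<^sub>3\<close>.\<close>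
definition pauli_op :: "real \<Rightarrow> real \<Rightarrow> real \<Rightarrow> real \<Rightarrow> real \<Rightarrow> real \<Rightarrow> complex mat" where
  "pauli_op a b c x y z = mat_of_rows_list 4
    [[Complex (1 + c) 0, Complex y z, Complex y (- z), Complex (a + b) 0],
     [Complex y (- z), Complex (1 - c) 0, Complex (a - b) (- 2 * x), Complex (- y) z],
     [Complex y z, Complex (a - b) (2 * x), Complex (1 - c) 0, Complex (- y) (- z)],
     [Complex (a + b) 0, Complex (- y) (- z), Complex (- y) z, Complex (1 + c) 0]]"

lemma mat_of_rows_list_4_carrier:
  "mat_of_rows_list 4 [r0, r1, r2, r3] \<in> carrier_mat 4 4"
  by (rule carrier_matI) (simp_all add: mat_of_rows_list_def)

lemma mat_of_rows_list_4_index: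
  assumes "p < 4" "q < 4"
  shows "mat_of_rows_list 4 [r0, r1, r2, r3] $$ (p, q) = [r0, r1, r2, r3] ! p ! q"
  using assms by (simp add: mat_of_rows_list_def)

lemma pauli_op_carrier [simp]: "pauli_op a b c x y z \<in> carrier_mat 4 4"
  by (simp add: pauli_op_def mat_of_rows_list_4_carrier)

lemma all_less_2: "(\<forall>i<2. P i) \<longleftrightarrow> P 0 \<and> P (1 :: nat)"
  by (auto simp: less_2_cases_iff)

text \<open>The conditions are linear in the entries of \<open>A\<close>. They determine all sixteen from those at
  \<open>(0, 0)\<close>, \<open>(1, 0)\<close>, \<open>(2, 1)\<close> and \<open>(3, 0)\<close>, of which the first and the last are real: six real
  parameters in all, as many as for \<open>Q\<close>.\<close>
lemma pauli_op_exists: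
  assumes A: "A \<in> carrier_mat 4 4" and u: "undirected_graph 2 tau A" and r: "reflexive_graph 2 tau 2 A"
  obtains a b c x y z where "A = pauli_op a b c x y z"
proof -
  let ?A = "\<lambda>p q. A $$ (p, q)"
  define a b c x y z where
    "a = (Re (?A 3 0) + Re (?A 2 1)) / 2" and "b = (Re (?A 3 0) - Re (?A 2 1)) / 2" and
    "c = Re (?A 0 0) - 1" and "x = Im (?A 2 1) / 2" and "y = Re (?A 1 0)" and "z = - Im (?A 1 0)"
  note defs = this
  note r' = r[unfolded reflexive_graph_tau_iff[OF A] all_less_2 sum_lessThan_2, simplified]
  note u' = u[unfolded undirected_graph_tau_iff[OF A] all_less_2, simplified]
  have real: "?A 0 0 = cnj (?A 0 0)" "?A 3 0 = cnj (?A 3 0)" using u' by blast+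
  have off: "?A 0 1 = cnj (?A 1 0)" "?A 2 0 = cnj (?A 1 0)" "?A 0 2 = ?A 1 0" "?A 0 3 = ?A 3 0"
    "?A 1 2 = cnj (?A 2 1)" "?A 3 2 = ?A 1 3" "?A 2 3 = cnj (?A 1 3)" "?A 3 1 = cnj (?A 1 3)"
    "?A 2 2 = ?A 1 1"
    using u' unfolding One_nat_def by (metis complex_cnj_cnj)+
  have diag: "?A 1 1 = 2 - ?A 0 0" "?A 1 3 = - ?A 1 0" "?A 3 3 = ?A 0 0"
    using r' off unfolding One_nat_def
    by (simp_all add: algebra_simps add_eq_0_iff) (metis add_left_cancel add.commute)
  have ab: "a + b = Re (?A 3 0)" "a - b = Re (?A 2 1)"
    by (simp_all add: defs(1,2) field_simps)
  have "A = pauli_op a b c x y z"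
    unfolding mat_4_eq_iff[OF A pauli_op_carrier] all_less_2
    using real off diag
    by (simp add: pauli_op_def mat_of_rows_list_4_index complex_eq_iff ab defs(3-))
  then show ?thesis by (rule that)
qed

text \<open>The Choi matrix is \<open>\<Sum>k l. c\<^sub>k\<^sub>l \<cdot> (\<sigma>\<^sub>k \<sigma>\<^sub>l\<^sup>*)\<close> with \<open>c = 1 \<oplus> Q\<close> and the \<open>\<sigma>\<^sub>k\<close> read as orthogonal
  vectors of squared length \<open>2\<close>. Hence its square is twice itself iff \<open>Q\<^sup>2 = Q\<close>; the equations for
  \<open>Q\<close> are linear combinations of those for the entries.\<close>
lemma pauli_op_projection:
  assumes "quantum_graph 2 tau 2 (pauli_op a b c x y z)"
  shows "a * a + x * x + y * y = a" "x * x + b * b + z * z = b" "y * y + z * z + c * c = c"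
    "a * x + x * b + y * z = x" "a * y + x * z + y * c = y" "x * y + b * z + z * c = z"
proof -
  note q = assms[unfolded quantum_graph_tau_iff all_less_2 sum_lessThan_2, simplified]
  have "a * a + x * x + y * y = a \<and> x * x + b * b + z * z = b \<and> y * y + z * z + c * c = c \<and>
    a * x + x * b + y * z = x \<and> a * y + x * z + y * c = y \<and> x * y + b * z + z * c = z"
    using q
    by (simp add: pauli_op_def mat_of_rows_list_4_index complex_eq_iff, elim conjE,
        simp only: algebra_simps, intro conjI) linarith+
  then show "a * a + x * x + y * y = a" "x * x + b * b + z * z = b" "y * y + z * z + c * c = c"
    "a * x + x * b + y * z = x" "a * y + x * z + y * c = y" "x * y + b * z + z * c = z"
    by auto
qed

text \<open>This is \<open>n\<^sub>1 \<sigma>\<^sub>1 + n\<^sub>2 \<sigma>\<^sub>2 + n\<^sub>3 \<sigma>\<^sub>3\<close>.\<close>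
definition spin :: "real \<Rightarrow> real \<Rightarrow> real \<Rightarrow> complex mat" where
  "spin n1 n2 n3 = mat_of_rows_list 2
     [[Complex n3 0, Complex n1 (- n2)], [Complex n1 n2, Complex (- n3) 0]]"

lemma spin_carrier [simp]: "spin n1 n2 n3 \<in> carrier_mat 2 2"
  by (rule carrier_matI) (simp_all add: spin_def mat_of_rows_list_def)

lemma spin_dim [simp]: "dim_row (spin n1 n2 n3) = 2" "dim_col (spin n1 n2 n3) = 2"
  using spin_carrier by blast+

lemma spin_index:
  "spin n1 n2 n3 $$ (0, 0) = Complex n3 0" "spin n1 n2 n3 $$ (0, Suc 0) = Complex n1 (- n2)"
  "spin n1 n2 n3 $$ (Suc 0, 0) = Complex n1 n2" "spin n1 n2 n3 $$ (Suc 0, Suc 0) = Complex (- n3) 0"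
  by (simp_all add: spin_def mat_of_rows_list_def)

text \<open>In row-by-row coordinates, \<open>kron U (map_mat cnj U)\<close> is the matrix of \<open>b \<mapsto> U * b * U\<^sup>*\<close>.\<close>
lemma kron_conj_index:
  assumes "U \<in> carrier_mat n n" "s < n" "t < n" "i < n" "j < n"
  shows "kron U (map_mat cnj U) $$ (s * n + t, i * n + j) = U $$ (s, i) * cnj (U $$ (t, j))"
proof -
  have "map_mat cnj U \<in> carrier_mat n n" using assms by simp
  from kron_index[OF assms(1) this assms(2,3,4,5)] show ?thesis using assms by simp
qed

lemma kron_conj_carrier:
  "U \<in> carrier_mat n n \<Longrightarrow> kron U (map_mat cnj U) \<in> carrier_mat (n * n) (n * n)"
  by auto

lemma kron_conj_carrier_2:
  "U \<in> carrier_mat 2 2 \<Longrightarrow> kron U (map_mat cnj U) \<in> carrier_mat 4 4"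
  using kron_conj_carrier[of U 2] by simp

lemma one_mat_4_index:
  assumes "s < 2" "t < 2" "i < 2" "j < 2"
  shows "1\<^sub>m 4 $$ (s * 2 + t, i * 2 + j) = (if s = i \<and> t = j then 1 else 0 :: complex)"
proof -
  have "s * 2 + t < 4" "i * 2 + j < 4" using assms by linarith+
  then show ?thesis using product_index_inj[OF assms(2,4)] by simp
qed

lemma pauli_op_0: "pauli_op 0 0 0 0 0 0 = 1\<^sub>m 4"
  by (subst mat_4_eq_iff, simp, simp, unfold all_less_2)
     (simp add: pauli_op_def mat_of_rows_list_4_index complex_eq_iff)

lemma pauli_op_rank_one:
  "pauli_op (n1 * n1) (n2 * n2) (n3 * n3) (n1 * n2) (n1 * n3) (n2 * n3)
    = 1\<^sub>m 4 + kron (spin n1 n2 n3) (map_mat cnj (spin n1 n2 n3))" (is "?L = _ + ?K")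
proof -
  have K: "?K \<in> carrier_mat 4 4" by (simp add: kron_conj_carrier_2)
  have R: "1\<^sub>m 4 + ?K \<in> carrier_mat 4 4" using K by simp
  have L_index: "\<forall>s<2. \<forall>t<2. \<forall>i<2. \<forall>j<2. ?L $$ (s * 2 + t, i * 2 + j)
      = (if s = i \<and> t = j then 1 else 0) + spin n1 n2 n3 $$ (s, i) * cnj (spin n1 n2 n3 $$ (t, j))"
    unfolding all_less_2
    by (simp add: pauli_op_def mat_of_rows_list_4_index spin_index complex_eq_iff)
  show ?thesis
    unfolding mat_4_eq_iff[OF pauli_op_carrier R]
  proof (intro allI impI)
    fix s t i j :: nat assume lt: "s < 2" "t < 2" "i < 2" "j < 2"
    then have "s * 2 + t < 4" "i * 2 + j < 4" by linarith+
    then have sum: "(1\<^sub>m 4 + ?K) $$ (s * 2 + t, i * 2 + j)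
        = 1\<^sub>m 4 $$ (s * 2 + t, i * 2 + j) + ?K $$ (s * 2 + t, i * 2 + j)"
      using K by (intro index_add_mat) auto
    show "?L $$ (s * 2 + t, i * 2 + j) = (1\<^sub>m 4 + ?K) $$ (s * 2 + t, i * 2 + j)"
      unfolding sum one_mat_4_index[OF lt] kron_conj_index[OF spin_carrier lt]
      by (rule L_index[rule_format, OF lt])
  qed
qed

text \<open>The operator for \<open>Q = 1\<close> is \<open>b \<mapsto> 4 \<tau>(b)\<close>, because \<open>b + (\<Sum>k. \<sigma>\<^sub>k * b * \<sigma>\<^sub>k)\<close> is twice the
  trace of \<open>b\<close> times the unit.
  The complement of a line takes away the term of that line.\<close>
lemma pauli_op_rank_two:
  assumes n: "n1 * n1 + n2 * n2 + n3 * n3 = 1"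
  shows "pauli_op (1 - n1 * n1) (1 - n2 * n2) (1 - n3 * n3) (- (n1 * n2)) (- (n1 * n3)) (- (n2 * n3))
    = pauli_op 1 1 1 0 0 0 - kron (spin n1 n2 n3) (map_mat cnj (spin n1 n2 n3))" (is "?L = ?J - ?K")
proof -
  have K: "?K \<in> carrier_mat 4 4" by (simp add: kron_conj_carrier_2)
  have R: "?J - ?K \<in> carrier_mat 4 4" using K by (rule minus_carrier_mat)
  have L_index: "\<forall>s<2. \<forall>t<2. \<forall>i<2. \<forall>j<2. ?L $$ (s * 2 + t, i * 2 + j)
      = ?J $$ (s * 2 + t, i * 2 + j) - spin n1 n2 n3 $$ (s, i) * cnj (spin n1 n2 n3 $$ (t, j))"
    unfolding all_less_2 using n
    by (simp add: pauli_op_def mat_of_rows_list_4_index spin_index complex_eq_iff)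
  show ?thesis
    unfolding mat_4_eq_iff[OF pauli_op_carrier R]
  proof (intro allI impI)
    fix s t i j :: nat assume lt: "s < 2" "t < 2" "i < 2" "j < 2"
    then have "s * 2 + t < 4" "i * 2 + j < 4" by linarith+
    then have diff: "(?J - ?K) $$ (s * 2 + t, i * 2 + j)
        = ?J $$ (s * 2 + t, i * 2 + j) - ?K $$ (s * 2 + t, i * 2 + j)"
      using K by (intro index_minus_mat) auto
    show "?L $$ (s * 2 + t, i * 2 + j) = (?J - ?K) $$ (s * 2 + t, i * 2 + j)"
      unfolding diff kron_conj_index[OF spin_carrier lt]
      by (rule L_index[rule_format, OF lt])
  qed
qed

text \<open>For a unit vector \<open>n\<close> the spin matrix has eigenvalues \<open>1\<close> and \<open>- 1\<close>, and \<open>U\<close> has orthonormal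
  eigenvectors as columns. The first one is \<open>(\<alpha>, \<beta>)\<close>, with \<open>\<alpha>\<close> normalised to be real: if \<open>\<theta>\<close> is
  the angle between \<open>n\<close> and the third axis, then \<open>\<alpha> = cos (\<theta> / 2)\<close>.\<close>
lemma spin_diagonalised:
  assumes n: "n1 * n1 + n2 * n2 + n3 * n3 = 1"
  obtains U where "U \<in> carrier_mat 2 2" "U * mat_adjoint U = 1\<^sub>m 2" "mat_adjoint U * U = 1\<^sub>m 2"
    "U * spin 0 0 1 = spin n1 n2 n3 * U"
proof -
  obtain \<alpha> :: real and \<beta> :: complex where
    norm: "\<alpha> * \<alpha> + (cmod \<beta>)\<^sup>2 = 1" and n3: "n3 = 2 * \<alpha> * \<alpha> - 1" and n12: "Complex n1 n2 = 2 * \<alpha> * \<beta>"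
  proof (cases "n3 = - 1")
    \<comment> \<open>The pole \<open>\<theta> = \<pi>\<close>, where the formula for \<open>\<beta>\<close> would divide by \<open>\<alpha> = 0\<close>.\<close>
    case True
    then have "n1 = 0" "n2 = 0" using n by (simp_all add: sum_squares_eq_zero_iff)
    then show ?thesis using that[of 0 1] True by (simp add: complex_eq_iff)
  next
    case False
    have "n3\<^sup>2 \<le> 1"
      using n zero_le_square[of n1] zero_le_square[of n2] unfolding power2_eq_square by linarith
    then have "n3 \<ge> - 1" using abs_square_le_1[of n3] by linarith
    with False have pos: "n3 + 1 > 0" by simp
    define \<alpha> where "\<alpha> = sqrt ((1 + n3) / 2)"
    have a: "\<alpha> * \<alpha> = (1 + n3) / 2" "\<alpha> > 0" using pos by (simp_all add: \<alpha>_def)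
    define \<beta> where "\<beta> = Complex (n1 / (2 * \<alpha>)) (n2 / (2 * \<alpha>))"
    have "(cmod \<beta>)\<^sup>2 = (n1 / (2 * \<alpha>))\<^sup>2 + (n2 / (2 * \<alpha>))\<^sup>2"
      by (simp add: \<beta>_def cmod_power2)
    also have "\<dots> = (n1 * n1 + n2 * n2) / (4 * (\<alpha> * \<alpha>))"
      by (simp add: power2_eq_square add_divide_distrib)
    also have "\<dots> = (1 - n3 * n3) / (2 * (1 + n3))"
    proof -
      have "n1 * n1 + n2 * n2 = 1 - n3 * n3" using n by simp
      moreover have "4 * ((1 + n3) / 2) = 2 * (1 + n3)" by simp
      ultimately show ?thesis unfolding a(1) by metis
    qed
    also have "\<dots> = (1 - n3) / 2"
      using pos by (simp add: field_simps)
    finally have "\<alpha> * \<alpha> + (cmod \<beta>)\<^sup>2 = 1" using a(1) by (simp add: field_simps)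
    moreover have "n3 = 2 * \<alpha> * \<alpha> - 1" using a(1) by simp
    moreover have "Complex n1 n2 = 2 * \<alpha> * \<beta>"
      using a(2) by (simp add: \<beta>_def complex_eq_iff)
    ultimately show ?thesis by (rule that)
  qed
  have bb: "\<beta> * cnj \<beta> = 1 - of_real \<alpha> * of_real \<alpha>"
    using norm by (metis complex_norm_square add_diff_cancel_left' of_real_1 of_real_diff of_real_mult)
  define U where "U = mat_of_rows_list 2 [[of_real \<alpha>, - cnj \<beta>], [\<beta>, of_real \<alpha>]]"
  have U: "U \<in> carrier_mat 2 2"
    by (rule carrier_matI) (simp_all add: U_def mat_of_rows_list_def)
  have Ui: "U $$ (0, 0) = of_real \<alpha>" "U $$ (0, Suc 0) = - cnj \<beta>" "U $$ (Suc 0, 0) = \<beta>"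
    "U $$ (Suc 0, Suc 0) = of_real \<alpha>"
    by (simp_all add: U_def mat_of_rows_list_def)
  have mat_2_eqI: "X = Y" if "X \<in> carrier_mat 2 2" "Y \<in> carrier_mat 2 2"
    "X $$ (0, 0) = Y $$ (0, 0)" "X $$ (0, 1) = Y $$ (0, 1)"
    "X $$ (1, 0) = Y $$ (1, 0)" "X $$ (1, 1) = Y $$ (1, 1)" for X Y :: "complex mat"
    using that by (intro eq_matI) (auto simp: less_2_cases_iff)
  have s12: "Complex n1 (- n2) = 2 * \<alpha> * cnj \<beta>" using n12 by (simp add: complex_eq_iff)
  have c3: "complex_of_real n3 = 2 * (of_real \<alpha> * of_real \<alpha>) - 1" by (simp add: n3)
  have unitary: "U * mat_adjoint U = 1\<^sub>m 2" "mat_adjoint U * U = 1\<^sub>m 2"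
    using U bb
    by (auto intro!: mat_2_eqI mult_carrier_mat[of _ 2 2 _ 2] simp del: index_mult_mat(1)
        simp: mat_mult_index[of _ 2 2 _ 2] sum_lessThan_2 Ui algebra_simps)
  have "U * spin 0 0 1 = spin n1 n2 n3 * U"
  proof (rule mat_2_eqI)
    show "U * spin 0 0 1 \<in> carrier_mat 2 2" "spin n1 n2 n3 * U \<in> carrier_mat 2 2"
      using U by (auto intro: mult_carrier_mat)
    have bb': "2 * of_real \<alpha> * cnj \<beta> * \<beta> = 2 * of_real \<alpha> * (1 - of_real \<alpha> * of_real \<alpha>)"
      "2 * of_real \<alpha> * \<beta> * cnj \<beta> = 2 * of_real \<alpha> * (1 - of_real \<alpha> * of_real \<alpha>)"
      by (simp_all add: bb[symmetric] mult_ac)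
    note entry = mat_mult_index[OF U spin_carrier] mat_mult_index[OF spin_carrier U]
    show "(U * spin 0 0 1) $$ (0, 0) = (spin n1 n2 n3 * U) $$ (0, 0)"
      "(U * spin 0 0 1) $$ (0, 1) = (spin n1 n2 n3 * U) $$ (0, 1)"
      "(U * spin 0 0 1) $$ (1, 0) = (spin n1 n2 n3 * U) $$ (1, 0)"
      "(U * spin 0 0 1) $$ (1, 1) = (spin n1 n2 n3 * U) $$ (1, 1)"
      by (simp_all add: entry sum_lessThan_2 Ui spin_index n12 s12 complex_of_real_def[symmetric]
            del: index_mult_mat(1), unfold c3 bb', simp_all add: algebra_simps)
  qed
  then show ?thesis by (rule that[OF U unitary])
qed

section \<open>Quantum isomorphisms preserve the degree\<close>

lemma coords_one: "i < n \<Longrightarrow> j < n \<Longrightarrow> coords n (1\<^sub>m n) $ (i * n + j) = (if i = j then 1 else 0)"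
  by (simp add: coords_index)

lemma apply_op_one_iff:
  assumes A: "A \<in> carrier_mat (n * n) (n * n)"
  shows "apply_op n A (1\<^sub>m n) = d \<cdot>\<^sub>m 1\<^sub>m n \<longleftrightarrow>
    (\<forall>r<n * n. (\<Sum>p<n * n. A $$ (r, p) * coords n (1\<^sub>m n) $ p) = d * coords n (1\<^sub>m n) $ r)"
proof -
  have ix: "apply_op n A (1\<^sub>m n) $$ (s, t) = (\<Sum>p<n * n. A $$ (s * n + t, p) * coords n (1\<^sub>m n) $ p)"
    if "s < n" "t < n" for s t
    using that product_index_less[OF that] mult_mat_vec_index[OF A coords_carrier]
    by (simp add: apply_op_def of_coords_def)
  show ?thesis
  proof
    assume eq: "apply_op n A (1\<^sub>m n) = d \<cdot>\<^sub>m 1\<^sub>m n"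
    show "\<forall>r<n * n. (\<Sum>p<n * n. A $$ (r, p) * coords n (1\<^sub>m n) $ p) = d * coords n (1\<^sub>m n) $ r"
    proof (intro allI impI)
      fix r assume "r < n * n"
      then obtain s t where st: "s < n" "t < n" "r = s * n + t" by (meson index_product_split)
      then show "(\<Sum>p<n * n. A $$ (r, p) * coords n (1\<^sub>m n) $ p) = d * coords n (1\<^sub>m n) $ r"
        using ix[OF st(1,2)] eq by (simp add: coords_one)
    qed
  next
    assume eq: "\<forall>r<n * n. (\<Sum>p<n * n. A $$ (r, p) * coords n (1\<^sub>m n) $ p) = d * coords n (1\<^sub>m n) $ r"
    show "apply_op n A (1\<^sub>m n) = d \<cdot>\<^sub>m 1\<^sub>m n"
    proof (rule eq_matI)
      fix s t assume "s < dim_row (d \<cdot>\<^sub>m 1\<^sub>m n)" "t < dim_col (d \<cdot>\<^sub>m 1\<^sub>m n)"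
      then have st: "s < n" "t < n" by auto
      then show "apply_op n A (1\<^sub>m n) $$ (s, t) = (d \<cdot>\<^sub>m 1\<^sub>m n) $$ (s, t)"
        using ix[OF st] eq product_index_less[OF st] by (simp add: coords_one)
    qed auto
  qed
qed

lemma iso_hom_index:
  assumes "i < m" "j < m" "s < K" "t < K"
  shows "iso_hom n m K P b $$ (i * K + s, j * K + t)
    = (\<Sum>p<n * n. P $$ (s * (m * m) + (i * m + j), p * K + t) * coords n b $ p)"
proof -
  have comp: "iso_component n m K P q b \<in> carrier_mat K K" for q
    by (simp add: iso_component_def)
  have "i * K + s < m * K" "j * K + t < m * K"
    using assms product_index_less by auto
  then have "iso_hom n m K P b $$ (i * K + s, j * K + t)
      = (\<Sum>q<m * m. kron (munit m q) (iso_component n m K P q b) $$ (i * K + s, j * K + t))"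
    by (simp add: iso_hom_def)
  also have "\<dots> = (\<Sum>q<m * m. munit m q $$ (i, j) * iso_component n m K P q b $$ (s, t))"
    using assms by (intro sum.cong refl kron_index[OF munit_carrier comp])
  also have "\<dots> = (\<Sum>q<m * m. if i * m + j = q then iso_component n m K P q b $$ (s, t) else 0)"
    using assms by (intro sum.cong refl) (auto simp: munit_def)
  also have "\<dots> = iso_component n m K P (i * m + j) b $$ (s, t)"
    using product_index_less[OF assms(1,2)] by simp
  finally show ?thesis
    using assms by (simp add: iso_component_def)
qed

text \<open>Unitality of the homomorphism belonging to \<open>P\<close> says that \<open>P\<close> maps \<open>1 \<otimes> h\<close> to \<open>h \<otimes> 1\<close>; this is
  the coefficient of \<open>h\<^sub>s \<otimes> e'\<^sub>q\<close> in the image of \<open>1 \<otimes> h\<^sub>t\<close>.\<close>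
lemma quantum_isomorphism_one:
  assumes "quantum_isomorphism K P (m, \<psi>', A') (n, \<psi>, A)" "s < K" "t < K" "q < m * m"
  shows "(\<Sum>p<n * n. P $$ (s * (m * m) + q, p * K + t) * coords n (1\<^sub>m n) $ p)
    = (if s = t then coords m (1\<^sub>m m) $ q else 0)"
proof -
  obtain i j where ij: "i < m" "j < m" "q = i * m + j"
    using assms(4) by (meson index_product_split)
  have "iso_hom n m K P (1\<^sub>m n) = 1\<^sub>m (m * K)"
    using assms(1) by (simp add: unital_star_hom_def)
  then have "iso_hom n m K P (1\<^sub>m n) $$ (i * K + s, j * K + t) = 1\<^sub>m (m * K) $$ (i * K + s, j * K + t)"
    by simp
  also have "\<dots> = (if i = j \<and> s = t then 1 else 0)"
    using assms ij product_index_less[OF ij(1) assms(2)] product_index_less[OF ij(2) assms(3)]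
    by (simp add: product_index_inj)
  finally show ?thesis
    using iso_hom_index[OF ij(1,2) assms(2,3)] ij by (simp add: coords_one)
qed

lemma sum_if_eq_left:
  fixes f :: "nat \<Rightarrow> complex"
  shows "t < n \<Longrightarrow> (\<Sum>i<n. f i * (if i = t then 1 else 0)) = f t"
  by (simp add: if_distrib cong: if_cong)

lemma kron_intertwiner_index:
  assumes P: "P \<in> carrier_mat (K * M) (N * K)" and A: "A \<in> carrier_mat N N" and A': "A' \<in> carrier_mat M M"
    and eq: "P * kron A (1\<^sub>m K) = kron (1\<^sub>m K) A' * P"
    and "s < K" "q < M" "p < N" "t < K"
  shows "(\<Sum>p'<N. P $$ (s * M + q, p' * K + t) * A $$ (p', p))
    = (\<Sum>q'<M. A' $$ (q, q') * P $$ (s * M + q', p * K + t))"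
proof -
  have r: "s * M + q < K * M" "p * K + t < N * K"
    using assms product_index_less by auto
  have KA: "kron A (1\<^sub>m K) \<in> carrier_mat (N * K) (N * K)" "kron (1\<^sub>m K) A' \<in> carrier_mat (K * M) (K * M)"
    using A A' by auto
  have "(P * kron A (1\<^sub>m K)) $$ (s * M + q, p * K + t)
      = (\<Sum>p'<N. \<Sum>t'<K. P $$ (s * M + q, p' * K + t') * kron A (1\<^sub>m K) $$ (p' * K + t', p * K + t))"
    unfolding mat_mult_index[OF P KA(1) r] sum_product_index ..
  also have "\<dots> = (\<Sum>p'<N. \<Sum>t'<K. P $$ (s * M + q, p' * K + t') * A $$ (p', p) * (if t' = t then 1 else 0))"
    using assms by (intro sum.cong refl) (simp add: kron_index[OF A one_carrier_mat])
  also have "\<dots> = (\<Sum>p'<N. P $$ (s * M + q, p' * K + t) * A $$ (p', p))"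
    using assms by (simp only: sum_if_eq_left)
  finally have l: "(P * kron A (1\<^sub>m K)) $$ (s * M + q, p * K + t)
    = (\<Sum>p'<N. P $$ (s * M + q, p' * K + t) * A $$ (p', p))" .
  have "(kron (1\<^sub>m K) A' * P) $$ (s * M + q, p * K + t)
      = (\<Sum>s'<K. \<Sum>q'<M. kron (1\<^sub>m K) A' $$ (s * M + q, s' * M + q') * P $$ (s' * M + q', p * K + t))"
    unfolding mat_mult_index[OF KA(2) P r] sum_product_index ..
  also have "\<dots> = (\<Sum>s'<K. (\<Sum>q'<M. A' $$ (q, q') * P $$ (s' * M + q', p * K + t)) * (if s' = s then 1 else 0))"
    unfolding sum_distrib_right
    using assms by (intro sum.cong refl) (simp add: kron_index[OF one_carrier_mat A'])
  also have "\<dots> = (\<Sum>q'<M. A' $$ (q, q') * P $$ (s * M + q', p * K + t))"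
    using assms by (simp only: sum_if_eq_left)
  finally show ?thesis using l eq by simp
qed

text \<open>Evaluate \<open>P (A \<otimes> id) = (id \<otimes> A') P\<close> at \<open>1 \<otimes> h\<close> for a basis vector \<open>h\<close>: the left-hand side is
  \<open>d \<cdot> (h \<otimes> 1)\<close> and the right-hand side is \<open>h \<otimes> A' 1\<close>.\<close>
lemma quantum_isomorphism_degree:
  assumes iso: "quantum_isomorphism K P (m, \<psi>', A') (n, \<psi>, A)" and K: "K > 0"
    and A: "A \<in> carrier_mat (n * n) (n * n)" and A': "A' \<in> carrier_mat (m * m) (m * m)"
    and d: "apply_op n A (1\<^sub>m n) = d \<cdot>\<^sub>m 1\<^sub>m n"
  shows "apply_op m A' (1\<^sub>m m) = d \<cdot>\<^sub>m 1\<^sub>m m"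
  unfolding apply_op_one_iff[OF A']
proof (intro allI impI)
  fix q assume q: "q < m * m"
  let ?c = "\<lambda>p. coords n (1\<^sub>m n) $ p" and ?P = "\<lambda>q p. P $$ (0 * (m * m) + q, p * K + 0)"
  have P: "P \<in> carrier_mat (K * (m * m)) ((n * n) * K)" and eq: "P * kron A (1\<^sub>m K) = kron (1\<^sub>m K) A' * P"
    using iso by auto
  have one: "(\<Sum>p<n * n. ?P r p * ?c p) = coords m (1\<^sub>m m) $ r" if "r < m * m" for r
    using quantum_isomorphism_one[OF iso K K that] by simp
  have "(\<Sum>q'<m * m. A' $$ (q, q') * coords m (1\<^sub>m m) $ q')
      = (\<Sum>q'<m * m. \<Sum>p<n * n. A' $$ (q, q') * ?P q' p * ?c p)"
    by (intro sum.cong refl) (simp add: one[symmetric] sum_distrib_left mult.assoc)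
  also have "\<dots> = (\<Sum>p<n * n. \<Sum>q'<m * m. A' $$ (q, q') * ?P q' p * ?c p)"
    by (rule sum.swap)
  also have "\<dots> = (\<Sum>p<n * n. \<Sum>p'<n * n. ?P q p' * A $$ (p', p) * ?c p)"
    using kron_intertwiner_index[OF P A A' eq K q _ K]
    by (intro sum.cong[OF refl]) (simp add: sum_distrib_right[symmetric])
  also have "\<dots> = (\<Sum>p'<n * n. \<Sum>p<n * n. ?P q p' * A $$ (p', p) * ?c p)"
    by (rule sum.swap)
  also have "\<dots> = (\<Sum>p'<n * n. ?P q p' * (d * ?c p'))"
  proof (intro sum.cong refl)
    fix p' assume "p' \<in> {..<n * n}"
    then have "(\<Sum>p<n * n. A $$ (p', p) * ?c p) = d * ?c p'"
      using d unfolding apply_op_one_iff[OF A] by blast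
    then show "(\<Sum>p<n * n. ?P q p' * A $$ (p', p) * ?c p) = ?P q p' * (d * ?c p')"
      by (simp add: sum_distrib_left[symmetric] mult.assoc)
  qed
  also have "\<dots> = d * (\<Sum>p'<n * n. ?P q p' * ?c p')"
    by (simp add: sum_distrib_left mult_ac)
  finally show "(\<Sum>q'<m * m. A' $$ (q, q') * coords m (1\<^sub>m m) $ q') = d * coords m (1\<^sub>m m) $ q"
    using one[OF q] by simp
qed

text \<open>Since \<open>1 \<otimes> h\<close> is mapped to \<open>h \<otimes> 1\<close>, the operator \<open>P\<close> vanishes only on the zero Hilbert space.\<close>
lemma quantum_isomorphism_nonzero:
  assumes iso: "quantum_isomorphism K P (m, \<psi>', A') (n, \<psi>, A)" and "m > 0"
  shows "P \<noteq> 0\<^sub>m (dim_row P) (dim_col P) \<longleftrightarrow> K > 0"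
proof
  assume "P \<noteq> 0\<^sub>m (dim_row P) (dim_col P)"
  moreover have "P \<in> carrier_mat (K * (m * m)) ((n * n) * K)" using iso by simp
  ultimately show "K > 0" by (intro gr0I) (auto intro: eq_matI)
next
  assume K: "K > 0"
  have q: "0 < m * m" using \<open>m > 0\<close> by simp
  have P: "P \<in> carrier_mat (K * (m * m)) ((n * n) * K)" using iso by simp
  have "coords m (1\<^sub>m m) $ 0 = 1" using coords_one[of 0 m 0] \<open>m > 0\<close> by simp
  then have "(\<Sum>p<n * n. P $$ (0 * (m * m) + 0, p * K + 0) * coords n (1\<^sub>m n) $ p) = 1"
    using quantum_isomorphism_one[OF iso K K q] by simp
  then obtain p where p: "p < n * n" "P $$ (0, p * K) \<noteq> 0"
    by (metis (no_types, lifting) add.right_neutral lessThan_iff mult_zero_left sum.neutral zero_neq_one)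
  have "p * K + 0 < (n * n) * K" using p(1) K by (rule product_index_less)
  then show "P \<noteq> 0\<^sub>m (dim_row P) (dim_col P)"
    using p(2) P K q by (metis add.right_neutral carrier_matD index_zero_mat(1) nat_0_less_mult_iff)
qed

section \<open>Conjugation by a unitary as a classical isomorphism\<close>

lemma iso_hom_conj:
  assumes U: "U \<in> carrier_mat n n" and b: "b \<in> carrier_mat n n"
  shows "iso_hom n n 1 (kron U (map_mat cnj U)) b = U * b * mat_adjoint U" (is "?L = _")
proof (rule eq_matI)
  fix i j assume "i < dim_row (U * b * mat_adjoint U)" "j < dim_col (U * b * mat_adjoint U)"
  then have ij: "i < n" "j < n" using U by auto
  have Ub: "U * b \<in> carrier_mat n n" using U b by simp
  have "?L $$ (i, j) = (\<Sum>p<n * n. kron U (map_mat cnj U) $$ (i * n + j, p) * coords n b $ p)"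
    using iso_hom_index[of i n j 0 1 0 n] ij by simp
  also have "\<dots> = (\<Sum>k<n. \<Sum>l<n. kron U (map_mat cnj U) $$ (i * n + j, k * n + l) * coords n b $ (k * n + l))"
    by (rule sum_product_index)
  also have "\<dots> = (\<Sum>k<n. \<Sum>l<n. U $$ (i, k) * b $$ (k, l) * cnj (U $$ (j, l)))"
    using ij by (intro sum.cong refl) (simp add: kron_conj_index[OF U] coords_index)
  also have "\<dots> = (\<Sum>l<n. \<Sum>k<n. U $$ (i, k) * b $$ (k, l) * cnj (U $$ (j, l)))"
    by (rule sum.swap)
  also have "\<dots> = (\<Sum>l<n. (U * b) $$ (i, l) * mat_adjoint U $$ (l, j))"
    using ij U by (intro sum.cong refl) (simp add: mat_mult_index[OF U b] sum_distrib_right del: index_mult_mat(1))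
  also have "\<dots> = (U * b * mat_adjoint U) $$ (i, j)"
    using ij U by (intro mat_mult_index[OF Ub, symmetric]) auto
  finally show "?L $$ (i, j) = (U * b * mat_adjoint U) $$ (i, j)" .
qed (use U in \<open>auto simp: iso_hom_def\<close>)

lemma conj_unital_star_hom:
  assumes U: "U \<in> carrier_mat n n" "U * mat_adjoint U = 1\<^sub>m n" "mat_adjoint U * U = 1\<^sub>m n"
  shows "unital_star_hom n n (iso_hom n n 1 (kron U (map_mat cnj U)))"
proof -
  note U' = mat_adjoint_carrier[OF U(1)]
  let ?f = "\<lambda>b. U * b * mat_adjoint U"
  have carr: "?f x \<in> carrier_mat n n" if "x \<in> carrier_mat n n" for x
    using that U(1) U' by auto
  have add: "?f (x + y) = ?f x + ?f y" if "x \<in> carrier_mat n n" "y \<in> carrier_mat n n" for x y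
  proof -
    have "U * (x + y) = U * x + U * y" by (rule mult_add_distrib_mat[OF U(1) that])
    then show ?thesis using that U(1) U' by (simp add: add_mult_distrib_mat[where nr = n and n = n and nc = n])
  qed
  have smult: "?f (c \<cdot>\<^sub>m x) = c \<cdot>\<^sub>m ?f x" if "x \<in> carrier_mat n n" for c x
    using that U(1) U' by (simp add: mult_smult_distrib[where n = n and nr = n and nc = n]
        mult_smult_assoc_mat[where n = n and nr = n and nc = n])
  have mult: "?f (x * y) = ?f x * ?f y" if xy: "x \<in> carrier_mat n n" "y \<in> carrier_mat n n" for x y
  proof -
    note assoc = assoc_mult_mat[where n\<^sub>1 = n and n\<^sub>2 = n and n\<^sub>3 = n and n\<^sub>4 = n]
    have "?f x * ?f y = U * x * (mat_adjoint U * (U * y * mat_adjoint U))"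
      using xy U(1) U' by (intro assoc) auto
    also have "mat_adjoint U * (U * y * mat_adjoint U) = (mat_adjoint U * (U * y)) * mat_adjoint U"
      using xy U(1) U' by (intro assoc[symmetric]) auto
    also have "mat_adjoint U * (U * y) = mat_adjoint U * U * y"
      using xy U(1) U' by (intro assoc[symmetric]) auto
    also have "\<dots> = y" using xy U(3) by simp
    also have "U * x * (y * mat_adjoint U) = U * x * y * mat_adjoint U"
      using xy U(1) U' by (intro assoc[symmetric]) auto
    also have "U * x * y = U * (x * y)"
      using xy U(1) U' by (intro assoc) auto
    finally show ?thesis by simp
  qed
  have star: "?f (mat_adjoint x) = mat_adjoint (?f x)" if x: "x \<in> carrier_mat n n" for x
  proof -
    have "mat_adjoint (?f x) = mat_adjoint (mat_adjoint U) * mat_adjoint (U * x)"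
      using x U(1) U' by (intro mat_adjoint_mult) auto
    also have "mat_adjoint (U * x) = mat_adjoint x * mat_adjoint U"
      using x U(1) by (intro mat_adjoint_mult) auto
    also have "mat_adjoint (mat_adjoint U) * (mat_adjoint x * mat_adjoint U) = U * mat_adjoint x * mat_adjoint U"
      using x U(1) U' by (simp add: assoc_mult_mat[where n\<^sub>1 = n and n\<^sub>2 = n and n\<^sub>3 = n and n\<^sub>4 = n])
    finally show ?thesis by simp
  qed
  have one: "?f (1\<^sub>m n) = 1\<^sub>m n" using U by simp
  show ?thesis
    unfolding unital_star_hom_def
    using carr add smult mult star one by (simp add: iso_hom_conj[OF U(1), unfolded One_nat_def])
qed

text \<open>Conjugation is multiplicative and unitary, so it commutes with the adjoint of multiplication.
  In entries, both sides are \<open>U\<^sub>a\<^sub>i \<cdot> cnj U\<^sub>e\<^sub>j\<close> if the inner indices \<open>b\<close> and \<open>c\<close> agree and \<open>0\<close>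
  otherwise.\<close>
lemma conj_comultiplicative:
  assumes U: "U \<in> carrier_mat n n" "U * mat_adjoint U = 1\<^sub>m n"
  defines "P \<equiv> kron U (map_mat cnj U)"
  shows "kron P P * mat_adjoint (mult_map n) = mat_adjoint (mult_map n) * P"
proof (rule eq_matI)
  let ?N = "n * n" and ?D = "mat_adjoint (mult_map n)"
  have P: "P \<in> carrier_mat ?N ?N" unfolding P_def by (rule kron_conj_carrier[OF U(1)])
  have PP: "kron P P \<in> carrier_mat (?N * ?N) (?N * ?N)" using P by simp
  have D: "?D \<in> carrier_mat (?N * ?N) ?N" by (rule mat_adjoint_carrier[OF mult_map_carrier])
  note Pix = kron_conj_index[OF U(1), folded P_def]
  fix x y assume "x < dim_row (?D * P)" "y < dim_col (?D * P)"
  then have x: "x < ?N * ?N" and y: "y < ?N" using P D by auto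
  from x obtain p q where pq: "p < ?N" "q < ?N" "x = p * ?N + q" by (meson index_product_split)
  from pq obtain a b where ab: "a < n" "b < n" "p = a * n + b" by (meson index_product_split)
  from pq obtain c e where ce: "c < n" "e < n" "q = c * n + e" by (meson index_product_split)
  from y obtain i j where ij: "i < n" "j < n" "y = i * n + j" by (meson index_product_split)
  have "(kron P P * ?D) $$ (x, y) = (\<Sum>z<?N * ?N. kron P P $$ (x, z) * mult_map n $$ (i * n + j, z))"
    unfolding mat_mult_index[OF PP D x y] unfolding ij(3)
    using ij by (intro sum.cong refl) (simp add: mult_map_adjoint_index)
  also have "\<dots> = (\<Sum>k<n. kron P P $$ (x, (i * n + k) * ?N + (k * n + j)))"
    using ij by (simp only: sum_mult_map)
  also have "\<dots> = (\<Sum>k<n. U $$ (a, i) * cnj (U $$ (e, j)) * (U $$ (c, k) * cnj (U $$ (b, k))))"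
  proof (intro sum.cong refl)
    fix k assume "k \<in> {..<n}"
    then have k: "k < n" by simp
    have "kron P P $$ (x, (i * n + k) * ?N + (k * n + j)) = P $$ (p, i * n + k) * P $$ (q, k * n + j)"
      unfolding pq(3) using pq k ij product_index_less by (intro kron_index[OF P P]) auto
    then show "kron P P $$ (x, (i * n + k) * ?N + (k * n + j))
        = U $$ (a, i) * cnj (U $$ (e, j)) * (U $$ (c, k) * cnj (U $$ (b, k)))"
      using ab ce ij k by (simp add: Pix)
  qed
  also have "\<dots> = (if b = c then U $$ (a, i) * cnj (U $$ (e, j)) else 0)"
    using unitary_orthonormal_rows[OF U ce(1) ab(2)] by (simp add: sum_distrib_left[symmetric])
  finally have lhs: "(kron P P * ?D) $$ (x, y) = (if b = c then U $$ (a, i) * cnj (U $$ (e, j)) else 0)" .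
  have "(?D * P) $$ (x, y) = (\<Sum>s<n. \<Sum>t<n. ?D $$ (x, s * n + t) * P $$ (s * n + t, y))"
    unfolding mat_mult_index[OF D P x y] sum_product_index ..
  also have "\<dots> = (\<Sum>s<n. \<Sum>t<n. if e = t \<and> (a = s \<and> b = c) then U $$ (s, i) * cnj (U $$ (t, j)) else 0)"
    using x ab ce ij unfolding pq(3)
    by (intro sum.cong refl) (auto simp: mult_map_adjoint_index mult_map_index Pix)
  also have "\<dots> = (\<Sum>s<n. if a = s \<and> b = c then U $$ (s, i) * cnj (U $$ (e, j)) else 0)"
    using ce by (simp add: sum_if_eq_conj)
  also have "\<dots> = (if b = c then U $$ (a, i) * cnj (U $$ (e, j)) else 0)"
    using ab by (subst sum_if_eq_conj) auto
  finally show "(kron P P * ?D) $$ (x, y) = (?D * P) $$ (x, y)"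
    using lhs by simp
qed (use U in \<open>auto simp: P_def\<close>)

lemma functional_mat_tau_index:
  assumes "k < 2" "l < 2"
  shows "functional_mat 2 tau $$ (0, k * 2 + l) = (if k = l then 1 / 2 else 0)"
proof -
  have "functional_mat 2 tau $$ (0, k * 2 + l) = tau (munit 2 (k * 2 + l))"
    using product_index_less[OF assms] by (simp add: functional_mat_def)
  then show ?thesis
    using assms munit_index[of _ 2 _ l k] by (auto simp: tau_def less_2_cases_iff)
qed

lemma conj_trace_preserving:
  assumes U: "U \<in> carrier_mat 2 2" "mat_adjoint U * U = 1\<^sub>m 2"
  shows "functional_mat 2 tau * kron U (map_mat cnj U) = functional_mat 2 tau" (is "?F * ?P = _")
proof (rule eq_matI)
  have F: "?F \<in> carrier_mat 1 (2 * 2)" by (simp add: functional_mat_def)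
  note P = kron_conj_carrier[OF U(1)]
  fix x y assume "x < dim_row ?F" "y < dim_col ?F"
  then have x: "x = 0" and y: "y < 2 * 2" using F by auto
  from y obtain i j where ij: "i < 2" "j < 2" "y = i * 2 + j" by (meson index_product_split)
  have less_one_nat: "0 < (1 :: nat)" by simp
  have "(?F * ?P) $$ (0, y) = (\<Sum>k<2. \<Sum>l<2. ?F $$ (0, k * 2 + l) * ?P $$ (k * 2 + l, y))"
    unfolding mat_mult_index[OF F P less_one_nat y] sum_product_index ..
  also have "\<dots> = (\<Sum>k<2. \<Sum>l<2. if k = l then U $$ (k, i) * cnj (U $$ (l, j)) / 2 else 0)"
    using ij by (intro sum.cong refl) (simp add: functional_mat_tau_index kron_conj_index[OF U(1)])
  also have "\<dots> = (\<Sum>k<2. U $$ (k, i) * cnj (U $$ (k, j))) / 2"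
    by (simp add: sum_lessThan_2 add_divide_distrib)
  also have "\<dots> = ?F $$ (0, y)"
    using ij by (simp add: unitary_orthonormal[OF U ij(1,2)] functional_mat_tau_index)
  finally show "(?F * ?P) $$ (x, y) = ?F $$ (x, y)" using x by simp
qed (use U in \<open>auto simp: functional_mat_def\<close>)

lemma conj_quantum_isomorphism:
  assumes U: "U \<in> carrier_mat 2 2" "U * mat_adjoint U = 1\<^sub>m 2" "mat_adjoint U * U = 1\<^sub>m 2"
    and A: "A \<in> carrier_mat 4 4" and B: "B \<in> carrier_mat 4 4"
    and eq: "kron U (map_mat cnj U) * B = A * kron U (map_mat cnj U)"
  shows "quantum_isomorphism 1 (kron U (map_mat cnj U)) (2, tau, A) (2, tau, B)"
proof -
  let ?P = "kron U (map_mat cnj U)" and ?D = "mat_adjoint (mult_map 2)"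
  have P: "?P \<in> carrier_mat 4 4" using kron_conj_carrier[OF U(1)] by simp
  have D: "?D \<in> carrier_mat 16 4" using mult_map_carrier[of 2] by auto
  have "kron ?P (1\<^sub>m 4) * kron (1\<^sub>m 4) ?P = kron ?P ?P"
    unfolding kron_mult[OF P one_carrier_mat one_carrier_mat P] right_mult_one_mat[OF P] left_mult_one_mat[OF P] ..
  moreover have "kron ?P ?P * comult_map 2 tau = comult_map 2 tau * ?P"
  proof -
    have PP: "kron ?P ?P \<in> carrier_mat 16 16" using kron_carrier[OF P P] by simp
    show ?thesis
      unfolding comult_map_tau mult_smult_distrib[OF PP D] mult_smult_assoc_mat[OF D P]
        conj_comultiplicative[OF U(1,2)] ..
  qed
  ultimately show ?thesis
    using P eq conj_unital_star_hom[OF U] conj_trace_preserving[OF U(1,3)]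
      kron_one_left kron_one_right
    by simp
qed

lemma conj_classically_isomorphic:
  assumes "U \<in> carrier_mat 2 2" "U * mat_adjoint U = 1\<^sub>m 2" "mat_adjoint U * U = 1\<^sub>m 2"
    and "A \<in> carrier_mat 4 4" and "B \<in> carrier_mat 4 4"
    and "kron U (map_mat cnj U) * B = A * kron U (map_mat cnj U)"
  shows "classically_isomorphic (2, tau, A) (2, tau, B)"
proof -
  note iso = conj_quantum_isomorphism[OF assms]
  have "kron U (map_mat cnj U) \<noteq> 0\<^sub>m (dim_row (kron U (map_mat cnj U))) (dim_col (kron U (map_mat cnj U)))"
    by (subst quantum_isomorphism_nonzero[OF iso pos2]) simp
  with iso show ?thesis
    unfolding classically_isomorphic_def by blast
qed

text \<open>Both sides are the matrix of \<open>b \<mapsto> (U * S) * b * (U * S)\<^sup>*\<close>.\<close>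
lemma conj_intertwines_spin:
  assumes U: "U \<in> carrier_mat n n" and S: "S \<in> carrier_mat n n" and T: "T \<in> carrier_mat n n"
    and eq: "U * S = T * U"
  shows "kron U (map_mat cnj U) * kron S (map_mat cnj S) = kron T (map_mat cnj T) * kron U (map_mat cnj U)"
proof -
  have cnj: "map_mat cnj X * map_mat cnj Y = map_mat cnj (X * Y)"
    if "X \<in> carrier_mat n n" "Y \<in> carrier_mat n n" for X Y
    using that by (intro eq_matI) (auto simp: scalar_prod_def)
  have "kron U (map_mat cnj U) * kron S (map_mat cnj S) = kron (U * S) (map_mat cnj (U * S))"
    using U S by (simp add: kron_mult[of _ n n _ n _ n n _ n] cnj)
  also have "\<dots> = kron T (map_mat cnj T) * kron U (map_mat cnj U)"
    using U T by (simp add: kron_mult[of _ n n _ n _ n n _ n] cnj eq)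
  finally show ?thesis .
qed

lemma pauli_op_complete_index:
  assumes "s < 2" "t < 2" "i < 2" "j < 2"
  shows "pauli_op 1 1 1 0 0 0 $$ (s * 2 + t, i * 2 + j) = (if s = t \<and> i = j then 2 else 0)"
proof -
  have "\<forall>s<2. \<forall>t<2. \<forall>i<2. \<forall>j<2.
      pauli_op 1 1 1 0 0 0 $$ (s * 2 + t, i * 2 + j) = (if s = t \<and> i = j then 2 else 0)"
    unfolding all_less_2 by (simp add: pauli_op_def mat_of_rows_list_4_index complex_eq_iff)
  then show ?thesis using assms by blast
qed

text \<open>The complete graph \<open>b \<mapsto> 4 \<tau>(b)\<close> commutes with conjugation because the trace and the unit are
  invariant: the two sums below are the invariance of \<open>1\<close> and that of \<open>\<tau>\<close>.\<close>
lemma conj_intertwines_complete: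
  assumes U: "U \<in> carrier_mat 2 2" "U * mat_adjoint U = 1\<^sub>m 2" "mat_adjoint U * U = 1\<^sub>m 2"
  shows "kron U (map_mat cnj U) * pauli_op 1 1 1 0 0 0 = pauli_op 1 1 1 0 0 0 * kron U (map_mat cnj U)"
    (is "?P * ?J = ?J * ?P")
proof -
  have P: "?P \<in> carrier_mat 4 4" using kron_conj_carrier[OF U(1)] by simp
  have PJ: "?P * ?J \<in> carrier_mat 4 4" "?J * ?P \<in> carrier_mat 4 4"
    using mult_carrier_mat[OF P pauli_op_carrier] mult_carrier_mat[OF pauli_op_carrier P] .
  have four: "{..<4} = {..<2 * (2 :: nat)}" by simp
  show ?thesis
    unfolding mat_4_eq_iff[OF PJ]
  proof (intro allI impI)
    fix s t i j :: nat assume lt: "s < 2" "t < 2" "i < 2" "j < 2"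
    then have lt4: "s * 2 + t < 4" "i * 2 + j < 4" by linarith+
    have "(?P * ?J) $$ (s * 2 + t, i * 2 + j)
        = (\<Sum>k<2. \<Sum>l<2. if k = l then (if i = j then 2 * (U $$ (s, k) * cnj (U $$ (t, l))) else 0) else 0)"
      unfolding mat_mult_index[OF P pauli_op_carrier lt4] four sum_product_index
      using lt by (intro sum.cong refl) (simp add: kron_conj_index[OF U(1)] pauli_op_complete_index)
    also have "\<dots> = (if i = j then 2 * (\<Sum>k<2. U $$ (s, k) * cnj (U $$ (t, k))) else 0)"
      by (simp add: sum_lessThan_2 distrib_left)
    also have "\<dots> = (if i = j \<and> s = t then 2 else 0)"
      unfolding unitary_orthonormal_rows[OF U(1,2) lt(1,2)] by simp
    also have "\<dots> = (if s = t then 2 * (\<Sum>k<2. U $$ (k, i) * cnj (U $$ (k, j))) else 0)"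
      unfolding unitary_orthonormal[OF U(1,3) lt(3,4)] by simp
    also have "\<dots> = (\<Sum>k<2. \<Sum>l<2. if k = l then (if s = t then 2 * (U $$ (k, i) * cnj (U $$ (l, j))) else 0) else 0)"
      by (simp add: sum_lessThan_2 distrib_left)
    also have "\<dots> = (?J * ?P) $$ (s * 2 + t, i * 2 + j)"
      unfolding mat_mult_index[OF pauli_op_carrier P lt4] four sum_product_index
      using lt by (intro sum.cong refl) (simp add: kron_conj_index[OF U(1)] pauli_op_complete_index)
    finally show "(?P * ?J) $$ (s * 2 + t, i * 2 + j) = (?J * ?P) $$ (s * 2 + t, i * 2 + j)" .
  qed
qed

section \<open>The four model graphs\<close>

lemma qgraph_mat_pauli:
  "qgraph_mat 1 = pauli_op 0 0 0 0 0 0" "qgraph_mat 2 = pauli_op 0 0 1 0 0 0"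
  "qgraph_mat 3 = pauli_op 1 1 0 0 0 0" "qgraph_mat 4 = pauli_op 1 1 1 0 0 0"
  by (simp_all add: qgraph_mat_def pauli_op_def complex_of_real_def[symmetric])

lemma qgraph_mat_carrier [simp]: "qgraph_mat d \<in> carrier_mat 4 4"
  by (rule carrier_matI) (simp_all add: qgraph_mat_def mat_of_rows_list_def)

lemma quantum_graph_qgraph_mat:
  assumes "d \<in> {1, 2, 3, 4}"
  shows "quantum_graph 2 tau 2 (qgraph_mat d)"
  unfolding quantum_graph_tau_iff all_less_2 sum_lessThan_2
  using assms by (auto simp: qgraph_mat_def mat_of_rows_list_4_index mat_of_rows_list_4_carrier)

lemma undirected_qgraph_mat:
  assumes "d \<in> {1, 2, 3, 4}"
  shows "undirected_graph 2 tau (qgraph_mat d)"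
  unfolding undirected_graph_tau_iff[OF qgraph_mat_carrier] all_less_2
  using assms by (auto simp: qgraph_mat_def mat_of_rows_list_4_index)

lemma reflexive_qgraph_mat:
  assumes "d \<in> {1, 2, 3, 4}"
  shows "reflexive_graph 2 tau 2 (qgraph_mat d)"
  unfolding reflexive_graph_tau_iff[OF qgraph_mat_carrier] all_less_2 sum_lessThan_2
  using assms by (auto simp: qgraph_mat_def mat_of_rows_list_4_index)

lemma apply_op_2_index:
  assumes "A \<in> carrier_mat 4 4" "s < 2" "t < 2"
  shows "apply_op 2 A b $$ (s, t) = A $$ (s * 2 + t, 0) * b $$ (0, 0) + A $$ (s * 2 + t, 1) * b $$ (0, 1)
    + A $$ (s * 2 + t, 2) * b $$ (1, 0) + A $$ (s * 2 + t, 3) * b $$ (1, 1)"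
proof -
  have "A \<in> carrier_mat (2 * 2) (2 * 2)" using assms by simp
  from apply_op_index[OF this assms(2,3)] show ?thesis by (simp add: sum_lessThan_2)
qed

lemma regular_qgraph_mat:
  assumes "d \<in> {1, 2, 3, 4}"
  shows "regular_graph 2 tau (of_nat d) (qgraph_mat d)"
  unfolding regular_graph_def
proof (intro conjI ballI)
  show "apply_op 2 (qgraph_mat d) (1\<^sub>m 2) = of_nat d \<cdot>\<^sub>m 1\<^sub>m 2"
  proof (rule eq_matI)
    fix s t assume "s < dim_row (of_nat d \<cdot>\<^sub>m 1\<^sub>m 2 :: complex mat)" "t < dim_col (of_nat d \<cdot>\<^sub>m 1\<^sub>m 2 :: complex mat)"
    then show "apply_op 2 (qgraph_mat d) (1\<^sub>m 2) $$ (s, t) = (of_nat d \<cdot>\<^sub>m 1\<^sub>m 2) $$ (s, t)"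
      using assms
      by (auto simp: apply_op_2_index less_2_cases_iff qgraph_mat_def mat_of_rows_list_4_index mat_of_rows_list_4_carrier)
  qed auto
  show "tau (apply_op 2 (qgraph_mat d) b) = of_nat d * tau b" for b
    using assms
    by (auto simp: tau_def apply_op_2_index qgraph_mat_def mat_of_rows_list_4_index mat_of_rows_list_4_carrier field_simps)
qed

lemma apply_op_complete: "apply_op 2 (qgraph_mat 4) b = (4 * tau b) \<cdot>\<^sub>m 1\<^sub>m 2"
proof (rule eq_matI)
  fix s t assume "s < dim_row ((4 * tau b) \<cdot>\<^sub>m 1\<^sub>m 2)" "t < dim_col ((4 * tau b) \<cdot>\<^sub>m 1\<^sub>m 2)"
  then show "apply_op 2 (qgraph_mat 4) b $$ (s, t) = ((4 * tau b) \<cdot>\<^sub>m 1\<^sub>m 2) $$ (s, t)"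
    by (auto simp: tau_def apply_op_2_index less_2_cases_iff qgraph_mat_def mat_of_rows_list_4_index mat_of_rows_list_4_carrier)
qed auto

lemma proots_linear_factors:
  fixes es :: "complex list"
  shows "proots (\<Prod>e\<leftarrow>es. [:- e, 1:]) = mset es"
proof (induction es)
  case (Cons e es)
  have "(\<Prod>e\<leftarrow>es. [:- e, 1:]) \<noteq> 0" by (auto simp: prod_list_zero_iff)
  then show ?case using Cons by (simp add: proots_mult del: mult_pCons_left)
qed simp

text \<open>Different Pauli matrices anticommute, so for diagonal \<open>Q\<close> the matrices \<open>\<sigma>\<^sub>0, \<dots>, \<sigma>\<^sub>3\<close> are
  eigenvectors with the listed eigenvalues. The columns of \<open>P\<close> below are these matrices, with
  \<open>\<i> \<sigma>\<^sub>2\<close> for \<open>\<sigma>\<^sub>2\<close>.\<close>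
lemma spectrum_pauli_op_diagonal:
  "spectrum_mset (pauli_op a b c 0 0 0)
    = {# of_real (1 + a + b + c), of_real (1 + a - b - c), of_real (1 - a + b - c), of_real (1 - a - b + c) #}"
proof -
  define P :: "complex mat" where
    "P = mat_of_rows_list 4 [[1, 0, 0, 1], [0, 1, 1, 0], [0, 1, -1, 0], [1, 0, 0, -1]]"
  define D :: "complex mat" where
    "D = mat_of_rows_list 4 [[of_real (1 + a + b + c), 0, 0, 0], [0, of_real (1 + a - b - c), 0, 0],
      [0, 0, of_real (1 - a + b - c), 0], [0, 0, 0, of_real (1 - a - b + c)]]"
  let ?A = "pauli_op a b c 0 0 0" and ?Q = "(1 / 2) \<cdot>\<^sub>m P"
  have P: "P \<in> carrier_mat 4 4" and D: "D \<in> carrier_mat 4 4"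
    by (simp_all add: P_def D_def mat_of_rows_list_4_carrier)
  have Q: "?Q \<in> carrier_mat 4 4" using P by simp
  have sum4: "(\<Sum>k<4. f k) = f 0 + f 1 + f 2 + f (3 :: nat)" for f :: "nat \<Rightarrow> complex"
    by (simp add: eval_nat_numeral)
  have PP: "P * P = 2 \<cdot>\<^sub>m 1\<^sub>m 4"
  proof (rule eq_matI)
    fix p q assume "p < dim_row (2 \<cdot>\<^sub>m 1\<^sub>m 4 :: complex mat)" "q < dim_col (2 \<cdot>\<^sub>m 1\<^sub>m 4 :: complex mat)"
    then have "p < 4" "q < 4" by auto
    then show "(P * P) $$ (p, q) = (2 \<cdot>\<^sub>m 1\<^sub>m 4) $$ (p, q)"
      unfolding mat_mult_index[OF P P \<open>p < 4\<close> \<open>q < 4\<close>] sum4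
      by (auto simp: less_4_iff P_def mat_of_rows_list_4_index)
  qed (use P in auto)
  have PQ: "P * ?Q = 1\<^sub>m 4" "?Q * P = 1\<^sub>m 4"
    unfolding mult_smult_distrib[OF P P] mult_smult_assoc_mat[OF P P] PP
    by (auto intro!: eq_matI)
  have "?A * P = P * D"
  proof (rule eq_matI)
    fix p q assume "p < dim_row (P * D)" "q < dim_col (P * D)"
    then have "p < 4" "q < 4" using P D by auto
    then show "(?A * P) $$ (p, q) = (P * D) $$ (p, q)"
      unfolding mat_mult_index[OF pauli_op_carrier P \<open>p < 4\<close> \<open>q < 4\<close>]
        mat_mult_index[OF P D \<open>p < 4\<close> \<open>q < 4\<close>] sum4
      by (auto simp: less_4_iff P_def D_def pauli_op_def mat_of_rows_list_4_index complex_eq_iff)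
  qed (use P D carrier_matD[OF pauli_op_carrier[of a b c 0 0 0]] in auto)
  then have "P * D * ?Q = ?A * P * ?Q"
    by simp
  also have "\<dots> = ?A * (P * ?Q)"
    by (rule assoc_mult_mat[OF pauli_op_carrier P Q])
  also have "\<dots> = ?A"
    unfolding PQ(1) by (rule right_mult_one_mat[OF pauli_op_carrier])
  finally have "?A = P * D * ?Q" ..
  from similar_mat_witI[OF PQ this pauli_op_carrier D P Q] have "similar_mat_wit ?A D P ?Q" .
  then have "char_poly ?A = char_poly D"
    by (intro char_poly_similar) (auto simp: similar_mat_def)
  also have "\<dots> = (\<Prod>e\<leftarrow>diag_mat D. [:- e, 1:])"
    using D by (intro char_poly_upper_triangular)
      (auto simp: upper_triangular_def less_4_iff less_Suc_eq numeral_2_eq_2 numeral_3_eq_3 D_def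
        mat_of_rows_list_def)
  also have "diag_mat D = [of_real (1 + a + b + c), of_real (1 + a - b - c),
      of_real (1 - a + b - c), of_real (1 - a - b + c)]"
    by (simp add: diag_mat_def D_def mat_of_rows_list_def upt_rec)
  finally show ?thesis
    unfolding spectrum_mset_def by (simp only: proots_linear_factors mset.simps)
qed

section \<open>Classification\<close>

lemma conj_intertwines_add:
  fixes P :: "complex mat"
  assumes "P \<in> carrier_mat n n" "A \<in> carrier_mat n n" "B \<in> carrier_mat n n"
    "A' \<in> carrier_mat n n" "B' \<in> carrier_mat n n"
    "P * A = A' * P" "P * B = B' * P"
  shows "P * (A + B) = (A' + B') * P" "P * (A - B) = (A' - B') * P"
  using assms
  by (simp_all add: mult_add_distrib_mat[of _ n n _ n] add_mult_distrib_mat[of _ n n _ _ n]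
      mult_minus_distrib_mat[of _ n n _ n] minus_mult_distrib_mat[of _ n n _ _ n])

lemma classically_isomorphic_refl:
  assumes "A \<in> carrier_mat 4 4"
  shows "classically_isomorphic (2, tau, A) (2, tau, A)"
proof -
  have "map_mat cnj (1\<^sub>m 2) = 1\<^sub>m 2" "mat_adjoint (1\<^sub>m 2) = (1\<^sub>m 2 :: complex mat)"
    by (auto intro!: eq_matI)
  then show ?thesis
    using assms by (intro conj_classically_isomorphic[of "1\<^sub>m 2"]) (auto simp: kron_one_one)
qed

lemma classically_isomorphic_qgraph_mat:
  assumes "quantum_graph 2 tau 2 A" "undirected_graph 2 tau A" "reflexive_graph 2 tau 2 A"
  shows "\<exists>d\<in>{1, 2, 3, 4}. classically_isomorphic (2, tau, A) (2, tau, qgraph_mat d)"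
proof -
  have A: "A \<in> carrier_mat 4 4" using assms(1) by (simp add: quantum_graph_def)
  obtain a b c x y z where Aeq: "A = pauli_op a b c x y z"
    using pauli_op_exists[OF A assms(2,3)] .
  note Q = pauli_op_projection[OF assms(1)[unfolded Aeq]]
  show ?thesis
  proof (rule projection_3_trace[OF Q])
    assume "a = 0" "b = 0" "c = 0" "x = 0" "y = 0" "z = 0"
    then have "A = qgraph_mat 1" unfolding qgraph_mat_pauli Aeq by simp
    then show ?thesis using classically_isomorphic_refl[OF A] by blast
  next
    assume "a = 1" "b = 1" "c = 1" "x = 0" "y = 0" "z = 0"
    then have "A = qgraph_mat 4" unfolding qgraph_mat_pauli Aeq by simp
    then show ?thesis using classically_isomorphic_refl[OF A] by blast
  next
    assume t: "a + b + c = 1"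
    obtain n1 n2 n3 :: real where n: "n1 * n1 + n2 * n2 + n3 * n3 = 1"
      and ab: "a = n1 * n1" "b = n2 * n2" "c = n3 * n3" "x = n1 * n2" "y = n1 * n3" "z = n2 * n3"
      using projection_3_rank_one[OF Q t] .
    obtain U where U: "U \<in> carrier_mat 2 2" "U * mat_adjoint U = 1\<^sub>m 2" "mat_adjoint U * U = 1\<^sub>m 2"
      and US: "U * spin 0 0 1 = spin n1 n2 n3 * U"
      using spin_diagonalised[OF n] .
    let ?P = "kron U (map_mat cnj U)"
    have P: "?P \<in> carrier_mat 4 4" by (rule kron_conj_carrier_2[OF U(1)])
    have eq: "A = 1\<^sub>m 4 + kron (spin n1 n2 n3) (map_mat cnj (spin n1 n2 n3))"
      "qgraph_mat 2 = 1\<^sub>m 4 + kron (spin 0 0 1) (map_mat cnj (spin 0 0 1))"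
      using pauli_op_rank_one[of n1 n2 n3] pauli_op_rank_one[of 0 0 1] unfolding Aeq qgraph_mat_pauli ab
      by simp_all
    have "?P * qgraph_mat 2 = A * ?P"
      unfolding eq
    proof (rule conj_intertwines_add(1)[OF P one_carrier_mat _ one_carrier_mat])
      show "?P * 1\<^sub>m 4 = 1\<^sub>m 4 * ?P"
        unfolding right_mult_one_mat[OF P] left_mult_one_mat[OF P] ..
      show "?P * kron (spin 0 0 1) (map_mat cnj (spin 0 0 1))
          = kron (spin n1 n2 n3) (map_mat cnj (spin n1 n2 n3)) * ?P"
        using conj_intertwines_spin[OF U(1) spin_carrier spin_carrier US] .
    qed (rule kron_conj_carrier_2[OF spin_carrier])+
    then have "classically_isomorphic (2, tau, A) (2, tau, qgraph_mat 2)"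
      using A by (intro conj_classically_isomorphic[OF U]) auto
    then show ?thesis by blast
  next
    assume t: "a + b + c = 2"
    \<comment> \<open>The complementary projection has rank one.\<close>
    have Q': "(1 - a) * (1 - a) + (- x) * (- x) + (- y) * (- y) = 1 - a"
      "(- x) * (- x) + (1 - b) * (1 - b) + (- z) * (- z) = 1 - b"
      "(- y) * (- y) + (- z) * (- z) + (1 - c) * (1 - c) = 1 - c"
      "(1 - a) * (- x) + (- x) * (1 - b) + (- y) * (- z) = - x"
      "(1 - a) * (- y) + (- x) * (- z) + (- y) * (1 - c) = - y"
      "(- x) * (- y) + (1 - b) * (- z) + (- z) * (1 - c) = - z"
      using Q by (simp_all add: algebra_simps)
    have t': "(1 - a) + (1 - b) + (1 - c) = 1" using t by simp
    obtain n1 n2 n3 :: real where n: "n1 * n1 + n2 * n2 + n3 * n3 = 1"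
      and ab: "1 - a = n1 * n1" "1 - b = n2 * n2" "1 - c = n3 * n3"
        "- x = n1 * n2" "- y = n1 * n3" "- z = n2 * n3"
      using projection_3_rank_one[OF Q' t'] .
    have ab': "a = 1 - n1 * n1" "b = 1 - n2 * n2" "c = 1 - n3 * n3"
      "x = - (n1 * n2)" "y = - (n1 * n3)" "z = - (n2 * n3)"
      using ab by simp_all
    obtain U where U: "U \<in> carrier_mat 2 2" "U * mat_adjoint U = 1\<^sub>m 2" "mat_adjoint U * U = 1\<^sub>m 2"
      and US: "U * spin 0 0 1 = spin n1 n2 n3 * U"
      using spin_diagonalised[OF n] .
    let ?P = "kron U (map_mat cnj U)"
    have P: "?P \<in> carrier_mat 4 4" by (rule kron_conj_carrier_2[OF U(1)])
    have eq: "A = pauli_op 1 1 1 0 0 0 - kron (spin n1 n2 n3) (map_mat cnj (spin n1 n2 n3))"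
      "qgraph_mat 3 = pauli_op 1 1 1 0 0 0 - kron (spin 0 0 1) (map_mat cnj (spin 0 0 1))"
      using pauli_op_rank_two[OF n] pauli_op_rank_two[of 0 0 1] unfolding Aeq qgraph_mat_pauli ab'
      by simp_all
    have "?P * qgraph_mat 3 = A * ?P"
      unfolding eq
    proof (rule conj_intertwines_add(2)[OF P pauli_op_carrier _ pauli_op_carrier])
      show "?P * kron (spin 0 0 1) (map_mat cnj (spin 0 0 1))
          = kron (spin n1 n2 n3) (map_mat cnj (spin n1 n2 n3)) * ?P"
        using conj_intertwines_spin[OF U(1) spin_carrier spin_carrier US] .
      show "?P * pauli_op 1 1 1 0 0 0 = pauli_op 1 1 1 0 0 0 * ?P"
        by (rule conj_intertwines_complete[OF U])
    qed (rule kron_conj_carrier_2[OF spin_carrier])+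
    then have "classically_isomorphic (2, tau, A) (2, tau, qgraph_mat 3)"
      using A by (intro conj_classically_isomorphic[OF U]) auto
    then show ?thesis by blast
  qed
qed

lemma classically_isomorphic_imp_quantum:
  "classically_isomorphic X Y \<Longrightarrow> quantum_isomorphic X Y"
  unfolding classically_isomorphic_def quantum_isomorphic_def by blast

lemma quantum_isomorphic_degree:
  assumes iso: "quantum_isomorphic (2, tau, A) (2, tau, qgraph_mat d)"
    and d: "d \<in> {1, 2, 3, 4}" and A: "A \<in> carrier_mat 4 4"
  shows "apply_op 2 A (1\<^sub>m 2) = of_nat d \<cdot>\<^sub>m 1\<^sub>m 2"
proof -
  obtain K P where KP: "quantum_isomorphism K P (2, tau, A) (2, tau, qgraph_mat d)"
    and "P \<noteq> 0\<^sub>m (dim_row P) (dim_col P)"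
    using iso unfolding quantum_isomorphic_def by blast
  then have "K > 0" using quantum_isomorphism_nonzero[OF KP] by simp
  then show ?thesis
    using regular_qgraph_mat[OF d] A
    by (intro quantum_isomorphism_degree[OF KP]) (simp_all add: regular_graph_def)
qed

theorem theorem3p1:
  shows
    "(\<forall>d \<in> {1, 2, 3, 4}.
        quantum_graph 2 tau 2 (qgraph_mat d) \<and>
        undirected_graph 2 tau (qgraph_mat d) \<and>
        reflexive_graph 2 tau 2 (qgraph_mat d) \<and>
        regular_graph 2 tau (of_nat d) (qgraph_mat d)) \<and>
     qgraph_mat 1 = 1\<^sub>m 4 \<and>
     (\<forall>b \<in> carrier_mat 2 2. apply_op 2 (qgraph_mat 4) b = (4 * tau b) \<cdot>\<^sub>m 1\<^sub>m 2) \<and>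
     spectrum_mset (qgraph_mat 1) = {#1, 1, 1, 1#} \<and>
     spectrum_mset (qgraph_mat 2) = {#2, 2, 0, 0#} \<and>
     spectrum_mset (qgraph_mat 3) = {#3, 1, 1, -1#} \<and>
     spectrum_mset (qgraph_mat 4) = {#4, 0, 0, 0#} \<and>
     (\<forall>A. quantum_graph 2 tau 2 A \<and> undirected_graph 2 tau A \<and> reflexive_graph 2 tau 2 A \<longrightarrow>
        (\<exists>d \<in> {1, 2, 3, 4}. \<forall>d' \<in> {1, 2, 3, 4}.
           (classically_isomorphic (2, tau, A) (2, tau, qgraph_mat d') \<longleftrightarrow> d' = d) \<and>
           (quantum_isomorphic (2, tau, A) (2, tau, qgraph_mat d') \<longleftrightarrow> d' = d)))"
proof (intro conjI ballI allI impI)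
  show "spectrum_mset (qgraph_mat 1) = {#1, 1, 1, 1#}" "spectrum_mset (qgraph_mat 2) = {#2, 2, 0, 0#}"
    "spectrum_mset (qgraph_mat 3) = {#3, 1, 1, -1#}" "spectrum_mset (qgraph_mat 4) = {#4, 0, 0, 0#}"
    unfolding qgraph_mat_pauli spectrum_pauli_op_diagonal by (simp_all add: add_mset_commute)
next
  fix A assume A: "quantum_graph 2 tau 2 A \<and> undirected_graph 2 tau A \<and> reflexive_graph 2 tau 2 A"
  then have carr: "A \<in> carrier_mat 4 4" by (simp add: quantum_graph_def)
  obtain d where d: "d \<in> {1, 2, 3, 4}" and cl: "classically_isomorphic (2, tau, A) (2, tau, qgraph_mat d)"
    using A classically_isomorphic_qgraph_mat by blast
  have unique: "d' = d" if "d' \<in> {1, 2, 3, 4}" "quantum_isomorphic (2, tau, A) (2, tau, qgraph_mat d')" for d'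
  proof -
    have "of_nat d' \<cdot>\<^sub>m 1\<^sub>m 2 = (of_nat d \<cdot>\<^sub>m 1\<^sub>m 2 :: complex mat)"
      using quantum_isomorphic_degree[OF that(2,1) carr]
        quantum_isomorphic_degree[OF classically_isomorphic_imp_quantum[OF cl] d carr] by simp
    then have "(of_nat d' \<cdot>\<^sub>m 1\<^sub>m 2) $$ (0, 0) = (of_nat d \<cdot>\<^sub>m 1\<^sub>m 2 :: complex mat) $$ (0, 0)" by simp
    then show ?thesis by simp
  qed
  show "\<exists>d\<in>{1, 2, 3, 4}. \<forall>d'\<in>{1, 2, 3, 4}.
      (classically_isomorphic (2, tau, A) (2, tau, qgraph_mat d') \<longleftrightarrow> d' = d) \<and>
      (quantum_isomorphic (2, tau, A) (2, tau, qgraph_mat d') \<longleftrightarrow> d' = d)"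
    using d cl unique classically_isomorphic_imp_quantum by (intro bexI[OF _ d]) metis
qed (use quantum_graph_qgraph_mat undirected_qgraph_mat reflexive_qgraph_mat regular_qgraph_mat
    apply_op_complete pauli_op_0 qgraph_mat_pauli in auto)

end
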